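(* Let $C\subset\mathbb{R}^d$ be a closed strictly convex integer cone with apex at $0$ and nonempty interior, and let $A$ be a $C$-coconvex integer polytope. Then, as rational functions of $x_1,\dots,x_d$, $$G(A)=-\sum_{a\in\mathrm{Vert}(A)\setminus\{0\}}x^a\,G(C'_a)+G(C)-1,$$ where $C'_a$ is the cone with apex at $0$ such that a small neighborhood of $0$ in $C'_a$ coincides with a small neighborhood of $0$ in $\overline{C\setminus A}-a$.
   Context: A cone is strictly convex if it is convex and contains no line. An integer cone is a cone of the form $\{t_1v_1+\dots+t_nv_n: t_1,\dots,t_n\ge 0\}$ with $v_1,\dots,v_n\in\mathbb{Z}^d$. A $C$-coconvex integer polytope is a set $A=C\setminus(\Delta\cup\{0\})$, where $\Delta\subset C$ is a closed convex set such that $C\setminus\Delta$ is bounded and nonempty and all vertices (extreme points) of $\Delta$ belong to $\mathbb{Z}^d$ (such $\Delta$ is a convex polyhedron). $\mathrm{Vert}(A)$ is the set of vertices of the (non-convex) polytope $\overline A$; $\mathrm{Vert}(A)\setminus\{0\}$ is the set of vertices of $\Delta$. Bars denote closures. $G$ is the generating function for integer points: for $a=(a_1,\dots,a_d)\in\mathbb{Z}^d$, $x^a=x_1^{a_1}\cdots x_d^{a_d}$; for a bounded set $X$, $G(X)=\sum_{a\in X\cap\mathbb{Z}^d}x^a$ (a Laurent polynomial); for a strictly convex integer cone $Q$ with apex $0$, $G(Q)$ is the rational function of $x_1,\dots,x_d$ to which the series $\sum_{a\in Q\cap\mathbb{Z}^d}x^a$ converges on a nonempty open subset of $(\mathbb{C}\setminus\{0\})^d$.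 *)

theory Defs
  imports
    "HOL-Analysis.Analysis"
    "HOL-Library.Poly_Mapping"
    "HOL-Computational_Algebra.Fraction_Field"
begin

section \<open>Rational functions in the variables \<open>x\<^sub>i\<close>\<close>

text \<open>
  An element of \<open>'n \<Rightarrow>\<^sub>0 int\<close> is an exponent vector; as \<open>'n\<close> will be finite, the finite-support
  condition is void. The fraction field of the ring of Laurent polynomials is the field of
  rational functions. The order on \<open>'n\<close> (the index set \<open>{1..d}\<close>) is used only because the
  library proves that \<open>poly_mapping\<close> is an integral domain under an ordering assumption.
\<close>

type_synonym 'n laurent = "('n \<Rightarrow>\<^sub>0 int) \<Rightarrow>\<^sub>0 complex"
type_synonym 'n ratfun = "'n laurent fract"

definition lattice_point :: "('n \<Rightarrow>\<^sub>0 int) \<Rightarrow> real ^ 'n" where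
  "lattice_point a = (\<chi> i. of_int (Poly_Mapping.lookup a i))"

definition monom_eval :: "complex ^ 'n \<Rightarrow> ('n \<Rightarrow>\<^sub>0 int) \<Rightarrow> complex" where
  "monom_eval x a = (\<Prod>i\<in>UNIV. (x $ i) powi (Poly_Mapping.lookup a i))"

definition laurent_eval :: "'n laurent \<Rightarrow> complex ^ 'n \<Rightarrow> complex" where
  "laurent_eval p x = (\<Sum>a\<in>Poly_Mapping.keys p. Poly_Mapping.lookup p a * monom_eval x a)"

definition ratfun_monom :: "('n::{finite,linorder} \<Rightarrow>\<^sub>0 int) \<Rightarrow> 'n ratfun" where
  "ratfun_monom a = Fract (Poly_Mapping.single a 1) 1"


section \<open>Generating functions of integer points\<close>

text \<open>The generating function of a bounded set.\<close>

definition gf_bounded :: "(real ^ 'n::{finite,linorder}) set \<Rightarrow> 'n ratfun" where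
  "gf_bounded X = (\<Sum>a | lattice_point a \<in> X. ratfun_monom a)"

text \<open>
  The generating function of a strictly convex integer cone. Convergence is unconditional,
  as there is no preferred order on the integer points.
\<close>

definition series_converges_to :: "(real ^ 'n::{finite,linorder}) set \<Rightarrow> 'n ratfun \<Rightarrow> bool" where
  "series_converges_to Q R \<longleftrightarrow>
     (\<exists>U p q. open U \<and> U \<noteq> {} \<and> (\<forall>x\<in>U. \<forall>i. x $ i \<noteq> 0) \<and>
        q \<noteq> 0 \<and> R = Fract p q \<and>
        (\<forall>x\<in>U. laurent_eval q x \<noteq> 0 \<and>
           (monom_eval x has_sum (laurent_eval p x / laurent_eval q x)) {a. lattice_point a \<in> Q}))"

definition gf_cone :: "(real ^ 'n::{finite,linorder}) set \<Rightarrow> 'n ratfun" where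
  "gf_cone Q = (THE R. series_converges_to Q R)"


section \<open>Cones and coconvex polytopes\<close>

definition integral_vec :: "real ^ 'n \<Rightarrow> bool" where
  "integral_vec v \<longleftrightarrow> (\<forall>i. v $ i \<in> \<int>)"

definition integer_cone :: "(real ^ 'n) set \<Rightarrow> bool" where
  "integer_cone C \<longleftrightarrow>
     (\<exists>V. finite V \<and> (\<forall>v\<in>V. integral_vec v) \<and>
          C = {\<Sum>v\<in>V. t v *\<^sub>R v | t. \<forall>v\<in>V. 0 \<le> t v})"

definition strictly_convex_cone :: "'a::real_vector set \<Rightarrow> bool" where
  "strictly_convex_cone C \<longleftrightarrow>
     cone C \<and> convex C \<and> \<not> (\<exists>p v. v \<noteq> 0 \<and> (\<forall>t. p + t *\<^sub>R v \<in> C))"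

definition coconvex_integer_complement ::
    "(real ^ 'n) set \<Rightarrow> (real ^ 'n) set \<Rightarrow> (real ^ 'n) set \<Rightarrow> bool" where
  "coconvex_integer_complement C A \<Delta> \<longleftrightarrow>
     closed \<Delta> \<and> convex \<Delta> \<and> \<Delta> \<subseteq> C \<and> bounded (C - \<Delta>) \<and> C - \<Delta> \<noteq> {} \<and>
     (\<forall>a. a extreme_point_of \<Delta> \<longrightarrow> integral_vec a) \<and> A = C - (\<Delta> \<union> {0})"

definition coconvex_integer_polytope :: "(real ^ 'n) set \<Rightarrow> (real ^ 'n) set \<Rightarrow> bool" where
  "coconvex_integer_polytope C A \<longleftrightarrow> (\<exists>\<Delta>. coconvex_integer_complement C A \<Delta>)"

text \<open>
  The vertices of \<open>A = C - (\<Delta> \<union> {0})\<close> are \<open>0\<close> and the vertices of \<open>\<Delta>\<close>. Here \<open>\<Delta>\<close> is recovered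
  as \<open>C - (A \<union> {0})\<close>; see \<open>coconvex_Vert\<close> below.
\<close>

definition Vert :: "'a::real_vector set \<Rightarrow> 'a set \<Rightarrow> 'a set" where
  "Vert C A = insert 0 {a. a extreme_point_of (C - (A \<union> {0}))}"

text \<open>
  The cone with apex \<open>0\<close> that agrees near \<open>0\<close> with the translate by \<open>-a\<close> of the closure of
  \<open>C - A\<close>. At most one cone does (\<open>local_cone_unique\<close>).
\<close>

definition is_local_cone ::
    "'a::real_normed_vector set \<Rightarrow> 'a set \<Rightarrow> 'a \<Rightarrow> 'a set \<Rightarrow> bool" where
  "is_local_cone C A a K \<longleftrightarrow>
     cone K \<and> (\<exists>e>0. K \<inter> ball 0 e = (\<lambda>x. x - a) ` closure (C - A) \<inter> ball 0 e)"

definition local_cone :: "'a::real_normed_vector set \<Rightarrow> 'a set \<Rightarrow> 'a \<Rightarrow> 'a set" where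
  "local_cone C A a = (THE K. is_local_cone C A a K)"

lemma local_cone_unique:
  assumes "is_local_cone C A a K" "is_local_cone C A a L"
  shows "K = L"
proof -
  have sub: "K \<subseteq> L" if KL: "is_local_cone C A a K" "is_local_cone C A a L" for K L
  proof
    fix x assume x: "x \<in> K"
    let ?S = "(\<lambda>x. x - a) ` closure (C - A)"
    obtain d where d: "d > 0" "K \<inter> ball 0 d = ?S \<inter> ball 0 d"
      using KL(1) unfolding is_local_cone_def by auto
    obtain e where e: "e > 0" "L \<inter> ball 0 e = ?S \<inter> ball 0 e"
      using KL(2) unfolding is_local_cone_def by auto
    have K: "cone K" and L: "cone L" using KL by (auto simp: is_local_cone_def)
    define t where "t = min d e / (2 * (norm x + 1))"
    have den: "2 * (norm x + 1) > 0" by (simp add: add_nonneg_pos)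
    have t: "t > 0" using d e den by (simp add: t_def)
    have "norm (t *\<^sub>R x) = t * norm x" using t by simp
    also have "\<dots> < t * (2 * (norm x + 1))"
      using t by (intro mult_strict_left_mono) (smt (verit) norm_ge_zero)+
    also have "\<dots> = min d e" using den by (simp add: t_def)
    finally have n: "norm (t *\<^sub>R x) < min d e" .
    have "t *\<^sub>R x \<in> K" using K x t by (simp add: cone_def)
    with n d have "t *\<^sub>R x \<in> ?S" by (metis IntD1 IntI mem_ball_0 min_less_iff_conj)
    with n e have "t *\<^sub>R x \<in> L" by (metis IntD1 IntI mem_ball_0 min_less_iff_conj)
    from mem_cone[OF L this, of "1 / t"] have "(1 / t) *\<^sub>R (t *\<^sub>R x) \<in> L" using t by simp
    thus "x \<in> L" using t by simp
  qed
  from sub assms show ?thesis by blast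
qed

lemma coconvex_Vert:
  assumes C: "cone C" and co: "coconvex_integer_complement C A \<Delta>"
  shows "C - (A \<union> {0}) = \<Delta>"
    and "Vert C A - {0} = {a. a extreme_point_of \<Delta>}"
proof -
  have \<Delta>: "convex \<Delta>" "\<Delta> \<subseteq> C" "bounded (C - \<Delta>)" "C - \<Delta> \<noteq> {}" "A = C - (\<Delta> \<union> {0})"
    using co by (auto simp: coconvex_integer_complement_def)
  have 0: "0 \<notin> \<Delta>"
  proof
    assume 0: "0 \<in> \<Delta>"
    obtain x where x: "x \<in> C" "x \<notin> \<Delta>" using \<Delta> by blast
    hence "x \<noteq> 0" using 0 by blast
    obtain B where B: "\<And>y. y \<in> C - \<Delta> \<Longrightarrow> norm y \<le> B" using \<Delta>(3) by (auto simp: bounded_iff)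
    define t where "t = (\<bar>B\<bar> + 1) / norm x + 1"
    have "t * norm x = \<bar>B\<bar> + 1 + norm x" and t: "t \<ge> 1"
      using \<open>x \<noteq> 0\<close> by (auto simp: t_def field_simps)
    moreover have "\<bar>B\<bar> + 1 + norm x > B" by (smt (verit) norm_ge_zero)
    ultimately have "norm (t *\<^sub>R x) > B" by simp
    moreover have "t *\<^sub>R x \<in> C" using C x t by (simp add: cone_def)
    ultimately have "t *\<^sub>R x \<in> \<Delta>" using B by force
    hence "(1 - 1 / t) *\<^sub>R 0 + (1 / t) *\<^sub>R (t *\<^sub>R x) \<in> \<Delta>"
      using \<Delta>(1) 0 t by (intro convexD) auto
    thus False using x t by simp
  qed
  show eq: "C - (A \<union> {0}) = \<Delta>" using \<Delta> 0 by blast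
  show "Vert C A - {0} = {a. a extreme_point_of \<Delta>}"
    using 0 unfolding Vert_def eq by (auto simp: extreme_point_of_def)
qed

end

theory Submission
  imports Defs
begin

text \<open>
  This is Brion's theorem for \<open>\<Delta>\<close>, whose recession cone is \<open>C\<close>. For vectors \<open>ws\<close> containing all
  differences of vertices and all generators of \<open>C\<close>, apply the product of the difference operators
  \<open>f \<mapsto> f - f(\<cdot> - w)\<close>, which is multiplication by the product \<open>q\<close> of the \<open>1 - x\<^sup>w\<close>, to indicator functions on
  the whole of Euclidean space. If a polyhedron is invariant along some \<open>w\<close> in \<open>ws\<close> on a large enough ball,
  the result vanishes at its centre. Hence for short \<open>w\<close> the image of the indicator of \<open>\<Delta>\<close> is supported
  near the vertices, where \<open>\<Delta>\<close> agrees with its tangent cones; so it equals the sum of the images of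
  the translated tangent cones. As \<open>1 - x\<^sup>w\<close> divides \<open>1 - x\<^bsup>Nw\<^esup>\<close>, this identity persists for the original \<open>ws\<close>.
  For a pointed cone the image has bounded support and is the numerator of the generating
  function over \<open>q\<close>, since a Laurent polynomial vanishing on an open set is zero.
\<close>

section \<open>Difference operators and Laurent polynomials\<close>

text \<open>No series or rational function is ever attached to \<Delta>. Since \<open>A\<close> is
  \<open>C\<close> without \<Delta> and the origin, \<open>q\<close> times the generating function
  of \<open>A\<close> has as coefficients the image of the indicator of \<open>C\<close>, minus that
  of \<Delta>, minus \<open>q\<close>. With one list \<open>ws\<close> for all cones,
  \<open>q\<close> is a common denominator and the theorem becomes an identity of coefficients. The
  obstacle is scale. The operators reach as far as the total length of \<open>ws\<close>, while
  \<Delta> agrees with a tangent cone only within a radius dictated by its shape, which may be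
  shorter than any lattice step. Dividing the directions by \<open>N\<close> cures this but leaves
  the lattice; hence the geometry concerns functions on Euclidean space, and lattice points return
  only through \<open>diffs_comp\<close>. Neither finiteness of the vertex set nor polyhedrality of
  \<Delta> is assumed. Vertices are bounded, because a far one would be a midpoint, and integral,
  hence finite in number; polyhedrality then follows from writing \<Delta> as the hull of its
  vertices plus \<open>C\<close>.\<close>

fun diffs :: "'a::ab_group_add list \<Rightarrow> ('a \<Rightarrow> 'b::ab_group_add) \<Rightarrow> 'a \<Rightarrow> 'b" where
  "diffs [] f = f"
| "diffs (w # ws) f = (\<lambda>y. diffs ws f y - diffs ws f (y - w))"

lemma diffs_add: "diffs ws (\<lambda>y. f y + g y) = (\<lambda>y. diffs ws f y + diffs ws g y)"
  by (induction ws) (auto simp: algebra_simps)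

lemma diffs_diff: "diffs ws (\<lambda>y. f y - g y) = (\<lambda>y. diffs ws f y - diffs ws g y)"
  by (induction ws) (auto simp: algebra_simps)

lemma diffs_zero: "diffs ws (\<lambda>_. 0) = (\<lambda>_. 0)"
  by (induction ws) auto

lemma diffs_sum: "diffs ws (\<lambda>y. \<Sum>i\<in>I. f i y) = (\<lambda>y. \<Sum>i\<in>I. diffs ws (f i) y)"
  by (induction I rule: infinite_finite_induct) (simp_all add: diffs_zero diffs_add)

lemma diffs_shift: "diffs ws (\<lambda>y. f (y - u)) y = diffs ws f (y - u)"
  by (induction ws arbitrary: y) (auto simp: algebra_simps)

text \<open>Used with \<open>h = lattice_point\<close>: an identity proved on Euclidean space
  restricts to exponent vectors.\<close>

lemma diffs_comp:
  assumes "\<And>a b. h (a - b) = h a - h b"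
  shows "diffs ws (\<lambda>b. f (h b)) b = diffs (map h ws) f (h b)"
  by (induction ws arbitrary: b) (auto simp: assms)

section \<open>Laurent polynomials: coefficients and evaluation\<close>

definition binomial_prod :: "('n::{finite,linorder} \<Rightarrow>\<^sub>0 int) list \<Rightarrow> 'n laurent" where
  "binomial_prod ws = (\<Prod>w\<leftarrow>ws. 1 - Poly_Mapping.single w 1)"

lemma lookup_single_mult:
  fixes p :: "'n::{finite,linorder} laurent"
  shows "Poly_Mapping.lookup (Poly_Mapping.single w c * p) b = c * Poly_Mapping.lookup p (b - w)"
proof (induction p rule: update_induct)
  case (update f a v)
  have "Poly_Mapping.update a v f = Poly_Mapping.single a v + f"
    using update by (intro poly_mapping_eqI)
      (auto simp: lookup_update lookup_add lookup_single when_def in_keys_iff)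
  with update show ?case
    by (auto simp: distrib_left lookup_add mult_single lookup_single when_def algebra_simps)
qed simp

lemma lookup_binomial_prod_mult:
  "Poly_Mapping.lookup (binomial_prod ws * p) = diffs ws (Poly_Mapping.lookup p)"
proof (induction ws)
  case (Cons w ws)
  have "binomial_prod (w # ws) * p =
      binomial_prod ws * p - Poly_Mapping.single w 1 * (binomial_prod ws * p)"
    by (simp add: binomial_prod_def algebra_simps)
  with Cons show ?case
    by (auto simp: lookup_minus lookup_single_mult)
qed (simp add: binomial_prod_def)

text \<open>Each factor has constant coefficient 1 because \<open>w\<close> is not 0, and Laurent
  polynomials form an integral domain.\<close>

lemma binomial_prod_nonzero:
  fixes ws :: "('n::{finite,linorder} \<Rightarrow>\<^sub>0 int) list"
  assumes "0 \<notin> set ws"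
  shows "binomial_prod ws \<noteq> 0"
proof -
  have "1 - Poly_Mapping.single w 1 \<noteq> (0 :: 'n laurent)" if "w \<noteq> 0" for w
  proof
    assume "1 - Poly_Mapping.single w 1 = (0 :: 'n laurent)"
    hence "Poly_Mapping.lookup (1 - Poly_Mapping.single w 1 :: 'n laurent) 0 = 0" by simp
    thus False using that by (simp add: lookup_minus lookup_single)
  qed
  thus ?thesis using assms
    by (simp add: binomial_prod_def prod_list_zero_iff image_iff) metis
qed

text \<open>Reading evaluation as an unconditional sum over all exponents puts Laurent polynomials
  and cone series on the same footing; the algebraic rules for \<open>laurent_eval\<close> then
  follow from uniqueness of sums.\<close>

lemma laurent_eval_has_sum:
  "((\<lambda>b. Poly_Mapping.lookup p b * monom_eval x b) has_sum laurent_eval p x) UNIV"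
  unfolding laurent_eval_def
  by (rule has_sum_finite_neutralI[of "Poly_Mapping.keys p"]) (auto simp: in_keys_iff)

lemma laurent_eval_eqI:
  "((\<lambda>b. Poly_Mapping.lookup p b * monom_eval x b) has_sum s) UNIV \<Longrightarrow> laurent_eval p x = s"
  using laurent_eval_has_sum has_sum_unique by blast

lemma monom_eval_nonzero:
  "\<forall>i. x $ i \<noteq> 0 \<Longrightarrow> monom_eval x a \<noteq> 0"
  by (simp add: monom_eval_def)

lemma monom_eval_add:
  "\<forall>i. x $ i \<noteq> 0 \<Longrightarrow> monom_eval x (a + b) = monom_eval x a * monom_eval x b"
  by (simp add: monom_eval_def lookup_add power_int_add prod.distrib)

lemma has_sum_diff:
  fixes f g :: "'a \<Rightarrow> complex"
  assumes "(f has_sum a) A" "(g has_sum b) A"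
  shows "((\<lambda>x. f x - g x) has_sum (a - b)) A"
  using has_sum_add[OF assms(1), of "\<lambda>x. - g x" "- b"] assms(2) by (simp add: has_sum_uminus)

lemma has_sum_shift:
  assumes x: "\<forall>i. x $ i \<noteq> 0" and s: "((\<lambda>b. f b * monom_eval x b) has_sum s) UNIV"
  shows "((\<lambda>b. f (b - w) * monom_eval x b) has_sum (monom_eval x w * s)) UNIV"
proof -
  have "((\<lambda>b. monom_eval x w * (f (b - w) * monom_eval x (b - w))) has_sum (monom_eval x w * s)) UNIV"
    by (intro has_sum_cmult_right)
      (use s in \<open>simp add: has_sum_reindex_bij_witness[of UNIV "\<lambda>b. b + w" "\<lambda>b. b - w" UNIV
          "\<lambda>b. f b * monom_eval x b" "\<lambda>b. f (b - w) * monom_eval x (b - w)" s s]\<close>)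
  moreover have "monom_eval x w * (f (b - w) * monom_eval x (b - w)) = f (b - w) * monom_eval x b" for b
    using monom_eval_add[OF x, of w "b - w"] by (simp add: algebra_simps)
  ultimately show ?thesis by simp
qed

text \<open>Unconditional sums may be reindexed by a shift, so multiplying the sum by
  \<open>1 - monom_eval x w\<close> acts on coefficients as one difference. For the indicator of a
  cone this turns the series into its numerator.\<close>

lemma has_sum_diffs:
  assumes x: "\<forall>i. x $ i \<noteq> 0" and s: "((\<lambda>b. f b * monom_eval x b) has_sum s) UNIV"
  shows "((\<lambda>b. diffs ws f b * monom_eval x b) has_sum ((\<Prod>w\<leftarrow>ws. 1 - monom_eval x w) * s)) UNIV"
proof (induction ws)
  case (Cons w ws)
  from has_sum_diff[OF Cons has_sum_shift[OF x Cons, of w]] show ?case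
    by (simp add: algebra_simps)
qed (use s in simp)

lemma laurent_eval_single_mult:
  fixes q :: "'n::{finite,linorder} laurent"
  assumes x: "\<forall>i. x $ i \<noteq> 0"
  shows "laurent_eval (Poly_Mapping.single a c * q) x = c * monom_eval x a * laurent_eval q x"
  using has_sum_cmult_right[OF has_sum_shift[OF x laurent_eval_has_sum[of q x], of a], of c]
  by (intro laurent_eval_eqI) (simp add: lookup_single_mult mult.assoc)

lemma laurent_eval_add: "laurent_eval (p + q) x = laurent_eval p x + laurent_eval q x"
  using has_sum_add[OF laurent_eval_has_sum[of p x] laurent_eval_has_sum[of q x]]
  by (intro laurent_eval_eqI) (simp add: lookup_add distrib_right)

lemma laurent_eval_minus: "laurent_eval (p - q) x = laurent_eval p x - laurent_eval q x"
  using has_sum_diff[OF laurent_eval_has_sum[of p x] laurent_eval_has_sum[of q x]]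
  by (intro laurent_eval_eqI) (simp add: lookup_minus left_diff_distrib)

lemma laurent_eval_one: "laurent_eval 1 x = 1"
  by (simp add: laurent_eval_def monom_eval_def keys_one)

lemma laurent_eval_mult:
  fixes p :: "'n::{finite,linorder} laurent"
  assumes x: "\<forall>i. x $ i \<noteq> 0"
  shows "laurent_eval (p * q) x = laurent_eval p x * laurent_eval q x"
proof (induction p rule: update_induct)
  case (update f a v)
  \<comment> \<open>The factor 1 lets \<open>laurent_eval_single_mult\<close> evaluate the lone
    monomial as well.\<close>
  have eq: "Poly_Mapping.update a v f = Poly_Mapping.single a v * 1 + f"
    using update by (intro poly_mapping_eqI)
      (auto simp: lookup_update lookup_add lookup_single when_def in_keys_iff)
  show ?case unfolding eq distrib_right laurent_eval_add update mult.assoc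
      laurent_eval_single_mult[OF x]
    by (simp add: laurent_eval_one algebra_simps)
qed (simp add: laurent_eval_def)

lemma laurent_eval_binomial_prod:
  assumes x: "\<forall>i. x $ i \<noteq> 0"
  shows "laurent_eval (binomial_prod ws) x = (\<Prod>w\<leftarrow>ws. 1 - monom_eval x w)"
  using has_sum_diffs[OF x laurent_eval_has_sum[of 1 x], of ws]
  by (intro laurent_eval_eqI) (simp add: laurent_eval_one flip: lookup_binomial_prod_mult)

text \<open>To eliminate \<open>b\<close>, pick a coordinate \<open>i\<close> in which
  \<open>a\<close> and \<open>b\<close> differ and scale it by \<open>l\<close>. Subtracting the
  suitably multiplied original relation from the scaled one cancels \<open>b\<close> and multiplies
  \<open>c a\<close> by a difference of two powers of \<open>l\<close>. Both relations hold on a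
  smaller open set, so the induction must allow \<open>U\<close> to vary.\<close>

lemma monom_eval_independent:
  assumes "finite A" and "open U" and "U \<noteq> {}" and "\<And>x i. x \<in> U \<Longrightarrow> x $ i \<noteq> 0"
    and "\<And>x. x \<in> U \<Longrightarrow> (\<Sum>a\<in>A. c a * monom_eval x a) = 0"
    and "a \<in> A"
  shows "c a = 0"
  using assms
proof (induction A arbitrary: U c a rule: finite_induct)
  case (insert b A)
  have A: "c a = 0" if a: "a \<in> A" for a
  proof -
    obtain i where i: "Poly_Mapping.lookup a i \<noteq> Poly_Mapping.lookup b i"
      using a insert.hyps by (metis poly_mapping_eqI)
    define sc :: "real \<Rightarrow> complex ^ 'a \<Rightarrow> complex ^ 'a" where
      "sc l x = (\<chi> j. if j = i then of_real l * x $ j else x $ j)" for l x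
    have ev: "monom_eval (sc l x) a = of_real l powi Poly_Mapping.lookup a i * monom_eval x a" for l x a
    proof -
      have "monom_eval (sc l x) a = (\<Prod>j\<in>UNIV. (if j = i then of_real l powi Poly_Mapping.lookup a i else 1)
          * x $ j powi Poly_Mapping.lookup a j)"
        unfolding monom_eval_def sc_def by (intro prod.cong) (auto simp: power_int_mult_distrib)
      thus ?thesis by (simp add: prod.distrib monom_eval_def)
    qed
    obtain x0 where x0: "x0 \<in> U" using insert.prems by blast
    have cl: "continuous_on UNIV (\<lambda>l. sc l x0)"
      unfolding sc_def
    proof (intro continuous_on_vec_lambda)
      fix j show "continuous_on UNIV (\<lambda>l. if j = i then of_real l * x0 $ j else x0 $ j)"
        by (cases "j = i") (auto intro!: continuous_intros)
    qed
    have "open ((\<lambda>l. sc l x0) -` U)"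
      using cl insert.prems(1) by (simp add: open_vimage)
    moreover have "sc 1 x0 = x0" by (simp add: sc_def vec_eq_iff)
    ultimately obtain e where e: "e > 0" "ball 1 e \<subseteq> (\<lambda>l. sc l x0) -` U"
      using x0 by (metis openE vimageI2)
    \<comment> \<open>Close enough to 1 to keep the scaled point in \<open>U\<close>, yet a real
      number above 1, so that distinct exponents give distinct powers.\<close>
    define l where "l = 1 + e / 2"
    have "l \<in> ball 1 e" using e by (auto simp: l_def dist_real_def)
    hence l: "l > 1" "sc l x0 \<in> U" using e by (auto simp: l_def)
    have cx: "continuous_on UNIV (sc l)"
      unfolding sc_def
    proof (intro continuous_on_vec_lambda)
      fix j show "continuous_on UNIV (\<lambda>x :: complex ^ 'a. if j = i then of_real l * x $ j else x $ j)"
        by (cases "j = i") (simp_all add: bounded_linear.continuous_on linear_continuous_on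
          continuous_on_mult_left bounded_linear_vec_nth)
    qed
    have "open (U \<inter> sc l -` U)" using insert.prems(1) cx by (intro open_Int open_vimage)
    moreover have "U \<inter> sc l -` U \<noteq> {}" using x0 l by blast
    moreover have "(\<Sum>a\<in>A. (c a * (of_real l powi Poly_Mapping.lookup a i -
         of_real l powi Poly_Mapping.lookup b i)) * monom_eval x a) = 0" if "x \<in> U \<inter> sc l -` U" for x
    proof -
      have "(\<Sum>a\<in>insert b A. c a * monom_eval (sc l x) a) = 0"
           "(\<Sum>a\<in>insert b A. c a * monom_eval x a) = 0"
        using that insert.prems(4) by auto
      hence 1: "c b * monom_eval x b = - (\<Sum>a\<in>A. c a * monom_eval x a)"
        and 2: "of_real l powi Poly_Mapping.lookup b i * (c b * monom_eval x b) +
          (\<Sum>a\<in>A. c a * monom_eval (sc l x) a) = 0"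
        using insert.hyps by (auto simp: ev eq_neg_iff_add_eq_0 algebra_simps)
      show ?thesis using 2 unfolding 1
        by (simp add: ev sum_distrib_left algebra_simps sum_subtractf)
    qed
    ultimately have "c a * (of_real l powi Poly_Mapping.lookup a i -
         of_real l powi Poly_Mapping.lookup b i) = 0"
      using insert.prems(3) a by (intro insert.IH[of "U \<inter> sc l -` U" "\<lambda>a. c a * (of_real l powi
         Poly_Mapping.lookup a i - of_real l powi Poly_Mapping.lookup b i)"]) auto
    moreover have "l powi Poly_Mapping.lookup a i \<noteq> l powi Poly_Mapping.lookup b i"
      using i l(1) by (metis linorder_neqE not_less_iff_gr_or_eq power_int_strict_increasing)
    ultimately show ?thesis
      by (metis mult_eq_0_iff of_real_eq_iff of_real_power_int right_minus_eq)
  qed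
  obtain x0 where x0: "x0 \<in> U" using insert.prems by blast
  with insert.prems(4)[OF x0] insert.hyps A have "c b * monom_eval x0 b = 0" by simp
  with monom_eval_nonzero[of x0 b] insert.prems(3)[OF x0] have "c b = 0" by simp
  with A insert.prems show ?case by auto
qed simp

lemma laurent_eval_zero_imp_zero:
  assumes "open U" "U \<noteq> {}" "\<And>x i. x \<in> U \<Longrightarrow> x $ i \<noteq> 0" "\<And>x. x \<in> U \<Longrightarrow> laurent_eval p x = 0"
  shows "p = 0"
proof (rule poly_mapping_eqI)
  fix a show "Poly_Mapping.lookup p a = Poly_Mapping.lookup 0 a"
    using monom_eval_independent[of "Poly_Mapping.keys p" U "Poly_Mapping.lookup p" a] assms
    by (cases "a \<in> Poly_Mapping.keys p") (auto simp: laurent_eval_def in_keys_iff)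
qed

section \<open>Difference operators on indicators of polyhedra\<close>

text \<open>\<open>diffs ws f y\<close> is a signed sum of values \<open>f (y - v)\<close> over the
  subsums \<open>v\<close> of \<open>ws\<close>, none longer than the total length.\<close>

lemma diffs_cong_local:
  fixes f g :: "'a::real_normed_vector \<Rightarrow> 'b::ab_group_add"
  assumes "\<And>z. dist y z \<le> (\<Sum>w\<leftarrow>ws. norm w) \<Longrightarrow> f z = g z"
  shows "diffs ws f y = diffs ws g y"
  using assms
proof (induction ws arbitrary: y)
  case (Cons w ws)
  have "diffs ws f y = diffs ws g y"
    by (intro Cons.IH Cons.prems) (simp add: add_increasing)
  moreover have "diffs ws f (y - w) = diffs ws g (y - w)"
  proof (intro Cons.IH Cons.prems)
    fix z assume "dist (y - w) z \<le> (\<Sum>w\<leftarrow>ws. norm w)"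
    moreover have "dist y z \<le> dist y (y - w) + dist (y - w) z" by (rule dist_triangle)
    ultimately show "dist y z \<le> (\<Sum>w\<leftarrow>w # ws. norm w)" by (simp add: dist_norm)
  qed
  ultimately show ?case by simp
qed simp

text \<open>The differences commute, so the one along \<open>w\<close> may be thought of as acting
  first; it already kills \<open>f\<close> within reach of \<open>y\<close>.\<close>

lemma diffs_periodic_local:
  fixes f :: "'a::real_normed_vector \<Rightarrow> 'b::ab_group_add"
  assumes "w \<in> set ws" and "\<And>z. dist y z \<le> (\<Sum>w\<leftarrow>ws. norm w) \<Longrightarrow> f z = f (z - w)"
  shows "diffs ws f y = 0"
  using assms
proof (induction ws arbitrary: y)
  case (Cons v ws)
  show ?case
  proof (cases "v = w")
    case True
    have "diffs ws f y = diffs ws (\<lambda>z. f (z - w)) y"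
      by (intro diffs_cong_local Cons.prems) (simp add: add_increasing)
    thus ?thesis using True by (simp add: diffs_shift)
  next
    case False
    have "diffs ws f y = 0"
      by (intro Cons.IH Cons.prems(2)) (use False Cons.prems(1) in \<open>auto simp: add_increasing\<close>)
    moreover have "diffs ws f (y - v) = 0"
    proof (intro Cons.IH Cons.prems(2))
      fix z assume "dist (y - v) z \<le> (\<Sum>w\<leftarrow>ws. norm w)"
      moreover have "dist y z \<le> dist y (y - v) + dist (y - v) z" by (rule dist_triangle)
      ultimately show "dist y z \<le> (\<Sum>w\<leftarrow>v # ws. norm w)" by (simp add: dist_norm)
    qed (use False Cons.prems(1) in auto)
    ultimately show ?thesis by simp
  qed
qed simp

text \<open>Divisibility read as periodicity: applying the induction hypothesis to the difference of
  \<open>f\<close> along \<open>w / N\<close> shows that \<open>diffs ws f\<close> has period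
  \<open>w / N\<close>, hence period \<open>w\<close> after \<open>N\<close> steps. The statement
  varies \<open>f\<close> to treat one direction at a time.\<close>

lemma diffs_eq_0_of_subdivision:
  fixes f :: "'a::real_vector \<Rightarrow> 'b::ab_group_add"
  assumes N: "N > 0" and "diffs (map (\<lambda>w. (1 / real N) *\<^sub>R w) ws) f = (\<lambda>_. 0)"
  shows "diffs ws f = (\<lambda>_. 0)"
  using assms(2)
proof (induction ws arbitrary: f)
  case (Cons w ws)
  let ?w = "(1 / real N) *\<^sub>R w"
  define g where "g = (\<lambda>y. f y - f (y - ?w))"
  have "diffs ws g = (\<lambda>_. 0)"
  proof (rule Cons.IH)
    show "diffs (map (\<lambda>w. (1 / real N) *\<^sub>R w) ws) g = (\<lambda>_. 0)"
      using Cons.prems by (simp add: g_def diffs_diff diffs_shift)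
  qed
  hence step: "diffs ws f (y - ?w) = diffs ws f y" for y
    by (auto simp: g_def diffs_diff diffs_shift fun_eq_iff)
  have "diffs ws f (y - real k *\<^sub>R ?w) = diffs ws f y" for y k
  proof (induction k)
    case (Suc k)
    have "y - real (Suc k) *\<^sub>R ?w = (y - real k *\<^sub>R ?w) - ?w"
      by (simp add: algebra_simps add_divide_distrib)
    thus ?case using step Suc by metis
  qed simp
  from this[of _ N] N show ?case by auto
qed simp

section \<open>Sets invariant along a direction near a point\<close>

text \<open>Arbitrary real multiples of \<open>w\<close> are allowed, so that the notion survives
  shrinking the directions. The last alternative serves points away from \<open>P\<close>, where no
  direction has to be singled out.\<close>

definition locally_invariant :: "'a::real_normed_vector list \<Rightarrow> 'a set \<Rightarrow> 'a \<Rightarrow> real \<Rightarrow> bool" where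
  "locally_invariant ws P y r \<longleftrightarrow>
     (\<exists>w\<in>set ws. \<forall>z s. z \<in> ball y r \<longrightarrow> z + s *\<^sub>R w \<in> ball y r \<longrightarrow> (z \<in> P \<longleftrightarrow> z + s *\<^sub>R w \<in> P))
     \<or> P \<inter> ball y r = {}"

lemma locally_invariant_mono:
  assumes "locally_invariant ws P x r" "ball y s \<subseteq> ball x r"
  shows "locally_invariant ws P y s"
  using assms unfolding locally_invariant_def by blast

lemma locally_invariant_cong:
  assumes "locally_invariant ws P y r" "\<And>z. z \<in> ball y r \<Longrightarrow> z \<in> P \<longleftrightarrow> z \<in> Q"
  shows "locally_invariant ws Q y r"
  using assms unfolding locally_invariant_def by blast

lemma locally_invariant_rescale:
  assumes "locally_invariant ws P y r"
  shows "locally_invariant (map (\<lambda>w. c *\<^sub>R w) ws) P y r"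
proof -
  have "\<forall>z s. z \<in> ball y r \<longrightarrow> z + s *\<^sub>R c *\<^sub>R w \<in> ball y r \<longrightarrow> (z \<in> P \<longleftrightarrow> z + s *\<^sub>R c *\<^sub>R w \<in> P)"
    if "\<forall>z s. z \<in> ball y r \<longrightarrow> z + s *\<^sub>R w \<in> ball y r \<longrightarrow> (z \<in> P \<longleftrightarrow> z + s *\<^sub>R w \<in> P)" for w
    using that by (metis scaleR_scaleR)
  thus ?thesis using assms unfolding locally_invariant_def by (simp, blast)
qed

lemma locally_invariant_cone:
  assumes K: "cone K" and c: "c > 0" and "locally_invariant ws K u r"
  shows "locally_invariant ws K (c *\<^sub>R u) (c * r)"
proof -
  have memK: "z \<in> K \<longleftrightarrow> (1 / c) *\<^sub>R z \<in> K" for z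
  proof
    show "z \<in> K \<Longrightarrow> (1 / c) *\<^sub>R z \<in> K" using K c by (simp add: mem_cone)
    show "(1 / c) *\<^sub>R z \<in> K \<Longrightarrow> z \<in> K" using mem_cone[OF K, of "(1 / c) *\<^sub>R z" c] c by simp
  qed
  have ball: "z \<in> ball (c *\<^sub>R u) (c * r) \<longleftrightarrow> (1 / c) *\<^sub>R z \<in> ball u r" for z
  proof -
    have "c *\<^sub>R u - z = c *\<^sub>R (u - (1 / c) *\<^sub>R z)" using c by (simp add: algebra_simps)
    hence "dist (c *\<^sub>R u) z = c * dist u ((1 / c) *\<^sub>R z)" using c by (simp add: dist_norm)
    thus ?thesis using c by simp
  qed
  show ?thesis using assms(3) unfolding locally_invariant_def
  proof (elim disjE bexE)
    fix w assume w: "w \<in> set ws" and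
      inv: "\<forall>z s. z \<in> ball u r \<longrightarrow> z + s *\<^sub>R w \<in> ball u r \<longrightarrow> (z \<in> K \<longleftrightarrow> z + s *\<^sub>R w \<in> K)"
    have "z \<in> K \<longleftrightarrow> z + s *\<^sub>R w \<in> K"
      if "z \<in> ball (c *\<^sub>R u) (c * r)" "z + s *\<^sub>R w \<in> ball (c *\<^sub>R u) (c * r)" for z s
      using that inv[rule_format, of "(1 / c) *\<^sub>R z" "s / c"] memK[of z] memK[of "z + s *\<^sub>R w"]
      unfolding ball by (simp add: scaleR_add_right)
    with w show "(\<exists>w\<in>set ws. \<forall>z s. z \<in> ball (c *\<^sub>R u) (c * r) \<longrightarrow> z + s *\<^sub>R w \<in> ball (c *\<^sub>R u) (c * r)
        \<longrightarrow> (z \<in> K \<longleftrightarrow> z + s *\<^sub>R w \<in> K)) \<or> K \<inter> ball (c *\<^sub>R u) (c * r) = {}" by blast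
  next
    assume "K \<inter> ball u r = {}"
    hence "K \<inter> ball (c *\<^sub>R u) (c * r) = {}" using memK ball by blast
    thus "(\<exists>w\<in>set ws. \<forall>z s. z \<in> ball (c *\<^sub>R u) (c * r) \<longrightarrow> z + s *\<^sub>R w \<in> ball (c *\<^sub>R u) (c * r)
        \<longrightarrow> (z \<in> K \<longleftrightarrow> z + s *\<^sub>R w \<in> K)) \<or> K \<inter> ball (c *\<^sub>R u) (c * r) = {}" by blast
  qed
qed

text \<open>The factor 2 leaves room for both \<open>z\<close> and \<open>z - w\<close>: the
  operators reach \<open>z\<close> within the total length of \<open>ws\<close>, and
  \<open>w\<close> itself is no longer than that.\<close>

lemma diffs_indicator_eq_0:
  assumes "locally_invariant ws P y r" and r: "2 * (\<Sum>w\<leftarrow>ws. norm w) < r"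
  shows "diffs ws (indicator P :: _ \<Rightarrow> complex) y = 0"
  using assms(1) unfolding locally_invariant_def
proof (elim disjE bexE)
  have nonneg: "0 \<le> (\<Sum>w\<leftarrow>ws. norm w)" by (intro sum_list_nonneg) auto
  {
    fix w assume w: "w \<in> set ws" and
      inv: "\<forall>z s. z \<in> ball y r \<longrightarrow> z + s *\<^sub>R w \<in> ball y r \<longrightarrow> (z \<in> P \<longleftrightarrow> z + s *\<^sub>R w \<in> P)"
    have nw: "norm w \<le> (\<Sum>w\<leftarrow>ws. norm w)" using w
      by (intro member_le_sum_list) auto
    show ?thesis
    proof (rule diffs_periodic_local[OF w])
      fix z assume z: "dist y z \<le> (\<Sum>w\<leftarrow>ws. norm w)"
      have "dist y (z - w) \<le> dist y z + dist z (z - w)" by (rule dist_triangle)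
      hence "z \<in> ball y r" "z + (- 1) *\<^sub>R w \<in> ball y r" using z nw r nonneg by (auto simp: dist_norm)
      with inv have "z \<in> P \<longleftrightarrow> z + (- 1) *\<^sub>R w \<in> P" by blast
      thus "(indicator P z :: complex) = indicator P (z - w)" by (simp add: indicator_def)
    qed
  next
    assume *: "P \<inter> ball y r = {}"
    have "diffs ws (indicator P :: _ \<Rightarrow> complex) y = diffs ws (\<lambda>_. 0) y"
    proof (rule diffs_cong_local)
      fix z assume "dist y z \<le> (\<Sum>w\<leftarrow>ws. norm w)"
      hence "z \<in> ball y r" using r nonneg by simp
      hence "z \<notin> P" using * by blast
      thus "indicator P z = (0 :: complex)" by simp
    qed
    thus ?thesis by (simp add: diffs_zero)
  }
qed

section \<open>Polyhedra and their active constraints\<close>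

text \<open>In contrast to \<open>polyhedron\<close>, a normal may be 0; the slice in
  \<open>finite_halfspaces_hull_plus_cone\<close> can produce such constraints.\<close>

definition finite_halfspaces :: "'a::real_inner set \<Rightarrow> bool" where
  "finite_halfspaces P \<longleftrightarrow> (\<exists>F. finite F \<and> P = {x. \<forall>(a, b)\<in>F. a \<bullet> x \<le> b})"

lemma finite_halfspaces_closed: "finite_halfspaces P \<Longrightarrow> closed P"
  unfolding finite_halfspaces_def
proof (elim exE conjE)
  fix F assume "P = {x. \<forall>(a, b)\<in>F. a \<bullet> x \<le> b}"
  hence "P = (\<Inter>p\<in>F. {x. fst p \<bullet> x \<le> snd p})" by (auto simp: split_beta)
  thus "closed P" by (simp add: closed_INT closed_halfspace_le)
qed

text \<open>Constraints strict at \<open>u\<close> stay strict on a neighbourhood, a finite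
  intersection of open halfspaces. Near \<open>u\<close>, only the active ones matter.\<close>

lemma active_constraints:
  assumes "finite F" and u: "\<forall>(a, b)\<in>F. a \<bullet> u \<le> b"
  obtains r where "r > 0"
    "\<And>z. dist u z < r \<Longrightarrow> (\<forall>(a, b)\<in>F. a \<bullet> z \<le> b) \<longleftrightarrow> (\<forall>(a, b)\<in>F. a \<bullet> u = b \<longrightarrow> a \<bullet> z \<le> b)"
proof -
  let ?G = "\<Inter>p\<in>{p \<in> F. fst p \<bullet> u < snd p}. {x. fst p \<bullet> x < snd p}"
  have "open ?G" using assms(1) by (intro open_INT) (auto intro: open_halfspace_lt)
  moreover have "u \<in> ?G" by auto
  ultimately obtain r where r: "r > 0" "ball u r \<subseteq> ?G" by (meson openE)
  show thesis
  proof (rule that[OF r(1)])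
    fix z assume "dist u z < r"
    hence z: "z \<in> ?G" using r(2) by (meson mem_ball subsetD)
    have "a \<bullet> z \<le> b" if "(a, b) \<in> F" "a \<bullet> u = b \<longrightarrow> a \<bullet> z \<le> b" for a b
    proof (cases "a \<bullet> u = b")
      case False
      hence "(a, b) \<in> {p \<in> F. fst p \<bullet> u < snd p}" using that(1) u by force
      hence "z \<in> {x. fst (a, b) \<bullet> x < snd (a, b)}" using z by (rule_tac INT_D)
      thus ?thesis by simp
    qed (use that in simp)
    thus "(\<forall>(a, b)\<in>F. a \<bullet> z \<le> b) \<longleftrightarrow> (\<forall>(a, b)\<in>F. a \<bullet> u = b \<longrightarrow> a \<bullet> z \<le> b)"
      by (simp add: Ball_def) blast
  qed
qed

text \<open>A constraint active at \<open>u\<close> that permits a step both ways along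
  \<open>w\<close> has its normal orthogonal to \<open>w\<close>; so no constraint that matters near
  \<open>u\<close> notices a motion along \<open>w\<close>.\<close>

lemma locally_invariant_halfspaces:
  assumes "finite_halfspaces P" and "w \<in> set ws" and t: "t > 0" and
    P: "u \<in> P" "u + t *\<^sub>R w \<in> P" "u - t *\<^sub>R w \<in> P"
  obtains r where "r > 0" "locally_invariant ws P u r"
proof -
  obtain F where F: "finite F" "P = {x. \<forall>(a, b)\<in>F. a \<bullet> x \<le> b}"
    using assms(1) by (auto simp: finite_halfspaces_def)
  have u: "\<forall>(a, b)\<in>F. a \<bullet> u \<le> b" using F P by auto
  obtain r where r: "r > 0"
    "\<And>z. dist u z < r \<Longrightarrow> (\<forall>(a, b)\<in>F. a \<bullet> z \<le> b) \<longleftrightarrow> (\<forall>(a, b)\<in>F. a \<bullet> u = b \<longrightarrow> a \<bullet> z \<le> b)"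
    using active_constraints[OF F(1) u] by blast
  have "a \<bullet> w = 0" if ab: "(a, b) \<in> F" "a \<bullet> u = b" for a b
  proof -
    have "a \<bullet> (u + t *\<^sub>R w) \<le> b" "a \<bullet> (u - t *\<^sub>R w) \<le> b"
      using P(2,3) ab(1) unfolding F(2) by auto
    hence "t * (a \<bullet> w) = 0" using ab by (simp add: inner_diff_right inner_add_right)
    thus ?thesis using t by simp
  qed
  hence "(\<forall>(a, b)\<in>F. a \<bullet> u = b \<longrightarrow> a \<bullet> z \<le> b) \<longleftrightarrow>
      (\<forall>(a, b)\<in>F. a \<bullet> u = b \<longrightarrow> a \<bullet> (z + s *\<^sub>R w) \<le> b)" for z s
    by (intro ball_cong) (auto simp: inner_add_right)
  hence "z \<in> P \<longleftrightarrow> z + s *\<^sub>R w \<in> P" if "z \<in> ball u r" "z + s *\<^sub>R w \<in> ball u r" for z s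
    using r(2)[of z] r(2)[of "z + s *\<^sub>R w"] that unfolding F(2) by simp
  with assms(2) have "locally_invariant ws P u r" unfolding locally_invariant_def by blast
  thus thesis using that r(1) by blast
qed

lemma locally_invariant_outside:
  assumes "closed P" "u \<notin> P"
  obtains r where "r > 0" "locally_invariant ws P u r"
proof -
  have "open (- P)" "u \<in> - P" using assms by auto
  then obtain r where "r > 0" "ball u r \<subseteq> - P" by (meson openE)
  thus thesis using that unfolding locally_invariant_def by blast
qed

text \<open>A Lebesgue number of the cover of \<open>S\<close> by balls of invariance is a radius
  that serves all points at once.\<close>

lemma locally_invariant_compact:
  assumes "compact S" "\<And>u. u \<in> S \<Longrightarrow> \<exists>r>0. locally_invariant ws P u r"
  obtains e where "e > 0" "\<And>u. u \<in> S \<Longrightarrow> locally_invariant ws P u e"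
proof -
  let ?G = "{ball u r | u r. r > 0 \<and> locally_invariant ws P u r}"
  have "S \<subseteq> \<Union>?G"
  proof
    fix u assume "u \<in> S"
    then obtain r where r: "r > 0" "locally_invariant ws P u r" using assms(2) by blast
    hence "ball u r \<in> ?G" "u \<in> ball u r" by auto
    thus "u \<in> \<Union>?G" by blast
  qed
  then obtain e where e: "e > 0" "\<And>u. u \<in> S \<Longrightarrow> \<exists>G\<in>?G. ball u e \<subseteq> G"
    by (rule Heine_Borel_lemma[OF assms(1)]) auto
  show thesis
  proof (rule that[OF e(1)])
    fix u assume "u \<in> S"
    then obtain v r where "locally_invariant ws P v r" "ball u e \<subseteq> ball v r" using e(2) by blast
    thus "locally_invariant ws P u e" by (rule locally_invariant_mono)
  qed
qed

text \<open>\<open>movable ws P u\<close>: some direction of \<open>ws\<close> is parallel to the minimal face of \<open>P\<close> at \<open>u\<close>.\<close>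

definition movable :: "'a::real_vector list \<Rightarrow> 'a set \<Rightarrow> 'a \<Rightarrow> bool" where
  "movable ws P u \<longleftrightarrow> (\<exists>w\<in>set ws. \<exists>t>0. u + t *\<^sub>R w \<in> P \<and> u - t *\<^sub>R w \<in> P)"

lemma locally_invariant_movable:
  assumes "finite_halfspaces P" "u \<in> P \<Longrightarrow> movable ws P u"
  shows "\<exists>r>0. locally_invariant ws P u r"
proof (cases "u \<in> P")
  case True
  then obtain w t where "w \<in> set ws" "t > 0" "u + t *\<^sub>R w \<in> P" "u - t *\<^sub>R w \<in> P"
    using assms(2) unfolding movable_def by blast
  from locally_invariant_halfspaces[OF assms(1) this(1,2) True this(3,4)] show ?thesis by blast
next
  case False
  thus ?thesis
    using locally_invariant_outside[OF finite_halfspaces_closed[OF assms(1)], of u ws] by blast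
qed

section \<open>Uniform radii of invariance away from the vertices\<close>

text \<open>Compactness gives one radius on the unit sphere; homogeneity makes it grow linearly with
  the distance from the apex. This growth is what eventually beats the fixed reach of the
  operators.\<close>

lemma locally_invariant_cone_uniform:
  fixes K :: "'a::euclidean_space set"
  assumes K: "cone K" "finite_halfspaces K" and mov: "\<And>u. u \<in> K \<Longrightarrow> u \<noteq> 0 \<Longrightarrow> movable ws K u"
  obtains e where "e > 0" "\<And>y. y \<noteq> 0 \<Longrightarrow> locally_invariant ws K y (e * norm y)"
proof -
  have "\<exists>r>0. locally_invariant ws K u r" if "u \<in> sphere 0 1" for u
    using that by (intro locally_invariant_movable K mov) auto
  then obtain e where e: "e > 0" "\<And>u. u \<in> sphere 0 1 \<Longrightarrow> locally_invariant ws K u e"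
    using locally_invariant_compact[OF compact_sphere] by blast
  show thesis
  proof (rule that[OF e(1)])
    fix y :: 'a assume y: "y \<noteq> 0"
    have "locally_invariant ws K ((1 / norm y) *\<^sub>R y) e" using y by (intro e(2)) simp
    from locally_invariant_cone[OF K(1) _ this, of "norm y"] y
    show "locally_invariant ws K y (e * norm y)" by (simp add: mult.commute)
  qed
qed

text \<open>Two regimes: far out \<open>P\<close> coincides with the cone \<open>K\<close>, whose
  radius of invariance is large; what remains, once balls around \<open>E\<close> are removed, is
  compact.\<close>

lemma locally_invariant_away:
  fixes P :: "'a::euclidean_space set"
  assumes P: "finite_halfspaces P" "\<And>u. u \<in> P \<Longrightarrow> u \<notin> E \<Longrightarrow> movable ws P u"
    and K: "cone K" "finite_halfspaces K" "\<And>u. u \<in> K \<Longrightarrow> u \<noteq> 0 \<Longrightarrow> movable ws K u"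
    and far: "\<And>z. norm z \<ge> B \<Longrightarrow> z \<in> P \<longleftrightarrow> z \<in> K" and \<eta>: "\<eta> > 0"
  obtains \<rho> where "\<rho> > 0" "\<And>y. (\<And>a. a \<in> E \<Longrightarrow> \<eta> \<le> dist a y) \<Longrightarrow> locally_invariant ws P y \<rho>"
proof -
  obtain e' where e': "e' > 0" "\<And>y. y \<noteq> 0 \<Longrightarrow> locally_invariant ws K y (e' * norm y)"
    using locally_invariant_cone_uniform[OF K(1,2), of ws] K(3) by blast
  \<comment> \<open>With \<open>e\<close> at most 1/2, a ball of radius \<open>e * R\<close> about a
    point of norm at least \<open>R\<close> stays outside radius \<open>R / 2\<close>, which exceeds
    \<open>B\<close> by the choice of \<open>R\<close> below. There \<open>P\<close> and
    \<open>K\<close> agree.\<close>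
  define e where "e = min e' (1 / 2)"
  have e: "e > 0" "e \<le> 1 / 2" "e \<le> e'" using e' by (auto simp: e_def)
  define R where "R = 2 * \<bar>B\<bar> + 1"
  have Rinv: "locally_invariant ws P y (e * R)" if y: "norm y \<ge> R" for y
  proof -
    have y0: "y \<noteq> 0" using y by (auto simp: R_def)
    have "locally_invariant ws K y (e' * norm y)" using e' y0 by blast
    moreover have "e * R \<le> e' * norm y" using e y by (intro mult_mono) (auto simp: R_def)
    ultimately have "locally_invariant ws K y (e * R)"
      by (rule locally_invariant_mono[OF _ subset_ball])
    moreover have "z \<in> K \<longleftrightarrow> z \<in> P" if z: "z \<in> ball y (e * R)" for z
    proof -
      have "norm y \<le> norm z + dist y z" by (metis dist_0_norm dist_commute dist_triangle)
      moreover have "e * R \<le> 1 / 2 * R" using e by (intro mult_right_mono) (auto simp: R_def)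
      ultimately have "norm z \<ge> B" using z y by (auto simp: R_def)
      with far show ?thesis by blast
    qed
    ultimately show ?thesis by (rule locally_invariant_cong)
  qed
  have "compact (cball 0 R - (\<Union>a\<in>E. ball a \<eta>))" by (intro compact_diff) auto
  moreover have "\<exists>r>0. locally_invariant ws P u r" if "u \<in> cball 0 R - (\<Union>a\<in>E. ball a \<eta>)" for u
    using that \<eta> by (intro locally_invariant_movable P) auto
  ultimately obtain d where d: "d > 0"
    "\<And>u. u \<in> cball 0 R - (\<Union>a\<in>E. ball a \<eta>) \<Longrightarrow> locally_invariant ws P u d"
    using locally_invariant_compact[of "cball 0 R - (\<Union>a\<in>E. ball a \<eta>)" ws P] by blast
  show thesis
  proof (rule that)
    show "min d (e * R) > 0" using d e by (simp add: R_def)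
    fix y assume y: "\<And>a. a \<in> E \<Longrightarrow> \<eta> \<le> dist a y"
    show "locally_invariant ws P y (min d (e * R))"
    proof (cases "norm y \<le> R")
      case True
      hence "y \<in> cball 0 R - (\<Union>a\<in>E. ball a \<eta>)" using y by force
      from locally_invariant_mono[OF d(2)[OF this] subset_ball] show ?thesis by simp
    next
      case False
      hence "norm y \<ge> R" by simp
      from locally_invariant_mono[OF Rinv[OF this] subset_ball] show ?thesis by simp
    qed
  qed
qed

lemma finite_uniform_pos:
  assumes "finite E" "\<And>a. a \<in> E \<Longrightarrow> \<exists>r>0::real. Q a r"
    and mono: "\<And>a r s. Q a r \<Longrightarrow> 0 < s \<Longrightarrow> s \<le> r \<Longrightarrow> Q a s"
  shows "\<exists>r>0. \<forall>a\<in>E. Q a r"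
  using assms(1,2)
proof (induction E rule: finite_induct)
  case empty
  show ?case by (rule exI[of _ 1]) simp
next
  case (insert b E)
  obtain r where r: "r > 0" "\<forall>a\<in>E. Q a r" using insert.IH insert.prems by blast
  obtain s where s: "s > 0" "Q b s" using insert.prems by blast
  have "Q a (min r s)" if "a \<in> insert b E" for a
    using that r s mono[of a r "min r s"] mono[of b s "min r s"] by auto
  thus ?case using r s by (intro exI[of _ "min r s"]) simp
qed

text \<open>
  Shrinking the directions to \<open>w / N\<close>, both sides vanish away from the vertices and agree near
  each of them; subdividing returns to the original directions.
\<close>

lemma diffs_indicator_tangent_cones:
  fixes P :: "'a::euclidean_space set" and T :: "'a \<Rightarrow> 'a set"
  assumes E: "finite E"
    and P: "finite_halfspaces P" "\<And>u. u \<in> P \<Longrightarrow> u \<notin> E \<Longrightarrow> movable ws P u"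
    and K: "cone K" "finite_halfspaces K" "\<And>u. u \<in> K \<Longrightarrow> u \<noteq> 0 \<Longrightarrow> movable ws K u"
    and far: "\<And>z. norm z \<ge> B \<Longrightarrow> z \<in> P \<longleftrightarrow> z \<in> K"
    and T: "\<And>a. a \<in> E \<Longrightarrow> cone (T a)" "\<And>a. a \<in> E \<Longrightarrow> finite_halfspaces (T a)"
      "\<And>a u. a \<in> E \<Longrightarrow> u \<in> T a \<Longrightarrow> u \<noteq> 0 \<Longrightarrow> movable ws (T a) u"
    and local: "\<And>a. a \<in> E \<Longrightarrow> \<exists>r>0. \<forall>z. dist a z < r \<longrightarrow> (z \<in> P \<longleftrightarrow> z - a \<in> T a)"
  shows "diffs ws (\<lambda>y. indicator P y - (\<Sum>a\<in>E. indicator (T a) (y - a)) :: complex) = (\<lambda>_. 0)"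
proof -
  have "\<exists>r>0. \<forall>a\<in>E. \<forall>z. dist a z < r \<longrightarrow> (z \<in> P \<longleftrightarrow> z - a \<in> T a)"
    by (rule finite_uniform_pos[OF E local]) simp_all
  then obtain r where r: "r > 0" "\<And>a z. a \<in> E \<Longrightarrow> dist a z < r \<Longrightarrow> z \<in> P \<longleftrightarrow> z - a \<in> T a"
    by blast
  have "\<exists>e>0. \<forall>a\<in>E. \<forall>y. y \<noteq> 0 \<longrightarrow> locally_invariant ws (T a) y (e * norm y)"
  proof (rule finite_uniform_pos[OF E])
    fix a assume a: "a \<in> E"
    obtain e where "e > 0" "\<And>y. y \<noteq> 0 \<Longrightarrow> locally_invariant ws (T a) y (e * norm y)"
      using locally_invariant_cone_uniform[OF T(1)[OF a] T(2)[OF a] T(3)[OF a]] by metis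
    thus "\<exists>e>0. \<forall>y. y \<noteq> 0 \<longrightarrow> locally_invariant ws (T a) y (e * norm y)" by blast
  next
    fix a e s assume e: "\<forall>y. y \<noteq> 0 \<longrightarrow> locally_invariant ws (T a) y (e * norm y)" "0 < s" "s \<le> e"
    show "\<forall>y. y \<noteq> 0 \<longrightarrow> locally_invariant ws (T a) y (s * norm y)"
    proof (intro allI impI)
      fix y :: 'a assume "y \<noteq> 0"
      moreover have "s * norm y \<le> e * norm y" using e by (intro mult_right_mono) auto
      ultimately show "locally_invariant ws (T a) y (s * norm y)"
        using e(1) by (meson locally_invariant_mono subset_ball)
    qed
  qed
  then obtain e where e: "e > 0"
    "\<And>a. a \<in> E \<Longrightarrow> \<forall>y. y \<noteq> 0 \<longrightarrow> locally_invariant ws (T a) y (e * norm y)"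
    by blast
  have "\<exists>s>0. \<forall>a\<in>E. \<forall>b\<in>E. b \<noteq> a \<longrightarrow> s \<le> dist a b"
  proof (rule finite_uniform_pos[OF E])
    fix a
    show "\<exists>s>0. \<forall>b\<in>E. b \<noteq> a \<longrightarrow> s \<le> dist a b"
    proof (rule finite_uniform_pos[OF E])
      fix b show "\<exists>s>0. b \<noteq> a \<longrightarrow> s \<le> dist a b"
        by (cases "b = a") (auto intro: exI[of _ 1] exI[of _ "dist a b"])
    qed auto
  qed force
  then obtain s where s: "s > 0" "\<And>a. a \<in> E \<Longrightarrow> \<forall>b\<in>E. b \<noteq> a \<longrightarrow> s \<le> dist a b"
    by blast
  \<comment> \<open>Half of \<open>r\<close> is kept in reserve for the reach of the operators; half
    of the least separation \<open>s\<close> ensures that a point close to one vertex is at distance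
    at least \<eta> from all others.\<close>
  define \<eta> where "\<eta> = min (r / 2) (s / 2)"
  have \<eta>: "\<eta> > 0" "\<eta> \<le> r / 2" "\<eta> \<le> s / 2" using r s by (auto simp: \<eta>_def)
  obtain \<rho> where \<rho>: "\<rho> > 0"
    "\<And>y. (\<And>a. a \<in> E \<Longrightarrow> \<eta> \<le> dist a y) \<Longrightarrow> locally_invariant ws P y \<rho>"
    using locally_invariant_away[OF P K far \<eta>(1)] by blast
  define L where "L = (\<Sum>w\<leftarrow>ws. norm w)"
  \<comment> \<open>The scale below which everything works: \<rho> for \<open>P\<close> away from
    \<open>E\<close>, \<open>e * \<eta>\<close> for each tangent cone at distance at least \<eta>
    from its apex, and \<open>r\<close> for the comparison near a vertex. \<open>N\<close> brings
    twice the total length under it.\<close>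
  define m where "m = min (min \<rho> (e * \<eta>)) r"
  have m: "m > 0" using \<rho> e \<eta> r by (simp add: m_def)
  obtain N :: nat where N: "real N > 2 * L / m" using reals_Archimedean2 by blast
  have L: "L \<ge> 0" unfolding L_def by (intro sum_list_nonneg) auto
  have "real N > 0" using N L m by (smt (verit) divide_nonneg_pos)
  hence N0: "N > 0" by simp
  define ws' where "ws' = map (\<lambda>w. (1 / real N) *\<^sub>R w) ws"
  have "(\<Sum>w\<leftarrow>ws'. norm w) = L / N"
    unfolding ws'_def L_def by (induction ws) (simp_all add: add_divide_distrib)
  moreover have "2 * (L / N) < m" using N m N0 by (simp add: field_simps)
  ultimately have small: "2 * (\<Sum>w\<leftarrow>ws'. norm w) < m" by simp
  have inv: "diffs ws' (indicator Q :: _ \<Rightarrow> complex) y = 0"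
    if "locally_invariant ws Q y t" "m \<le> t" for Q y t
    using locally_invariant_rescale[OF that(1), of "1 / real N"] small that(2)
    by (intro diffs_indicator_eq_0[of _ _ _ t]) (auto simp: ws'_def)
  have Tz: "diffs ws' (\<lambda>y. indicator (T a) (y - a) :: complex) y = 0"
    if a: "a \<in> E" and ay: "\<eta> \<le> dist a y" for a y
  proof -
    have "y - a \<noteq> 0" using ay \<eta>(1) by auto
    hence "locally_invariant ws (T a) (y - a) (e * norm (y - a))" using e(2)[OF a] by blast
    moreover have "m \<le> e * norm (y - a)"
    proof -
      have "m \<le> e * \<eta>" by (simp add: m_def)
      also have "\<dots> \<le> e * norm (y - a)"
        using ay e(1) by (intro mult_left_mono) (auto simp: dist_norm norm_minus_commute)
      finally show ?thesis .
    qed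
    ultimately show ?thesis unfolding diffs_shift by (rule inv)
  qed
  have "diffs ws' (\<lambda>y. indicator P y - (\<Sum>a\<in>E. indicator (T a) (y - a)) :: complex) y = 0" for y
  proof (cases "\<exists>a\<in>E. dist a y < \<eta>")
    case True
    then obtain a where a: "a \<in> E" "dist a y < \<eta>" by blast
    have "(\<Sum>b\<in>E. diffs ws' (\<lambda>y. indicator (T b) (y - b) :: complex) y) =
        (\<Sum>b\<in>{a}. diffs ws' (\<lambda>y. indicator (T b) (y - b) :: complex) y)"
    proof (rule sum.mono_neutral_right[OF E])
      show "\<forall>b\<in>E - {a}. diffs ws' (\<lambda>y. indicator (T b) (y - b) :: complex) y = 0"
      proof
        fix b assume b: "b \<in> E - {a}"
        hence "s \<le> dist a b" using s(2)[OF a(1)] by blast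
        also have "\<dots> \<le> dist a y + dist b y" by (rule dist_triangle2)
        finally have "\<eta> \<le> dist b y" using a(2) \<eta>(3) by simp
        with b show "diffs ws' (\<lambda>y. indicator (T b) (y - b) :: complex) y = 0"
          by (intro Tz) auto
      qed
    qed (use a in auto)
    moreover have "diffs ws' (indicator P :: _ \<Rightarrow> complex) y =
        diffs ws' (\<lambda>y. indicator (T a) (y - a) :: complex) y"
    proof (rule diffs_cong_local)
      fix z assume "dist y z \<le> (\<Sum>w\<leftarrow>ws'. norm w)"
      moreover have "dist a z \<le> dist a y + dist y z" by (rule dist_triangle)
      moreover have "m \<le> r" by (simp add: m_def)
      ultimately have "dist a z < r" using a(2) \<eta>(2) small by simp
      with r(2)[OF a(1)] show "(indicator P z :: complex) = indicator (T a) (z - a)"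
        by (simp add: indicator_def)
    qed
    ultimately show ?thesis by (subst diffs_diff, subst diffs_sum) simp
  next
    case False
    have "diffs ws' (indicator P :: _ \<Rightarrow> complex) y = 0"
      by (rule inv[OF \<rho>(2)]) (use False in \<open>auto simp: m_def not_less\<close>)
    moreover have "(\<Sum>a\<in>E. diffs ws' (\<lambda>y. indicator (T a) (y - a) :: complex) y) = 0"
      by (intro sum.neutral ballI Tz) (use False in auto)
    ultimately show ?thesis by (subst diffs_diff, subst diffs_sum) simp
  qed
  hence "diffs ws' (\<lambda>y. indicator P y - (\<Sum>a\<in>E. indicator (T a) (y - a)) :: complex) = (\<lambda>_. 0)"
    by (rule ext)
  thus ?thesis unfolding ws'_def by (rule diffs_eq_0_of_subdivision[OF N0])
qed

section \<open>Convergence of the series of a pointed cone\<close>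

lemma lattice_point_diff: "lattice_point (a - b) = lattice_point a - lattice_point b"
  by (simp add: lattice_point_def lookup_minus vec_eq_iff)

lemma lattice_point_0: "lattice_point 0 = 0"
  by (simp add: lattice_point_def vec_eq_iff)

lemma inj_lattice_point: "inj lattice_point"
  by (auto simp: inj_on_def lattice_point_def vec_eq_iff intro: poly_mapping_eqI)

lemma integral_vec_iff: "integral_vec v \<longleftrightarrow> v \<in> range (lattice_point :: ('n::finite \<Rightarrow>\<^sub>0 int) \<Rightarrow> _)"
proof
  assume "integral_vec v"
  hence "\<forall>i. \<exists>z. v $ i = of_int z" by (auto simp: integral_vec_def Ints_def)
  then obtain z where z: "\<And>i. v $ i = of_int (z i)" by metis
  have "lattice_point (Abs_poly_mapping z) = v"
    by (simp add: lattice_point_def vec_eq_iff z Abs_poly_mapping_inverse)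
  thus "v \<in> range lattice_point" by (metis rangeI)
qed (auto simp: integral_vec_def lattice_point_def)

lemma finite_bounded_lattice_points:
  fixes X :: "(real ^ 'n::finite) set"
  assumes "bounded X"
  shows "finite {a. lattice_point a \<in> X}"
proof -
  obtain B where B: "\<And>x. x \<in> X \<Longrightarrow> norm x \<le> B" using assms by (auto simp: bounded_iff)
  have "Poly_Mapping.lookup ` {a. lattice_point a \<in> X} \<subseteq> UNIV \<rightarrow>\<^sub>E {-\<lceil>B\<rceil>..\<lceil>B\<rceil>}"
  proof (rule image_subsetI)
    fix a :: "'n \<Rightarrow>\<^sub>0 int" assume "a \<in> {a. lattice_point a \<in> X}"
    hence a: "norm (lattice_point a) \<le> B" using B by simp
    have "Poly_Mapping.lookup a i \<in> {-\<lceil>B\<rceil>..\<lceil>B\<rceil>}" for i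
    proof -
      have "\<bar>real_of_int (Poly_Mapping.lookup a i)\<bar> \<le> B"
        using component_le_norm_cart[of "lattice_point a" i] a by (simp add: lattice_point_def)
      thus ?thesis by (simp add: le_ceiling_iff) linarith
    qed
    thus "Poly_Mapping.lookup a \<in> UNIV \<rightarrow>\<^sub>E {-\<lceil>B\<rceil>..\<lceil>B\<rceil>}" by (simp add: PiE_UNIV_domain)
  qed
  moreover have "finite (UNIV \<rightarrow>\<^sub>E {-\<lceil>B\<rceil>..\<lceil>B\<rceil>} :: ('n \<Rightarrow> int) set)" by (intro finite_PiE) auto
  ultimately have "finite (Poly_Mapping.lookup ` {a. lattice_point a \<in> X})" by (rule finite_subset)
  thus ?thesis by (rule finite_imageD) (simp add: inj_on_def)
qed

text \<open>The l1 norm makes the summand a product over coordinates. A finite set of exponents lies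
  in a box, over which the sum factors into truncated two-sided geometric series.\<close>

lemma summable_exp_l1:
  fixes \<eta> :: real
  assumes \<eta>: "\<eta> > 0"
  shows "(\<lambda>b :: 'n::finite \<Rightarrow>\<^sub>0 int. exp (- \<eta> * (\<Sum>i\<in>UNIV. \<bar>real_of_int (Poly_Mapping.lookup b i)\<bar>)))
    summable_on UNIV"
proof (rule nonneg_bdd_above_summable_on)
  define g where "g k = exp (- \<eta> * \<bar>of_int k\<bar>)" for k :: int
  define r where "r = exp (- \<eta>)"
  have r: "0 < r" "r < 1" using \<eta> by (auto simp: r_def)
  have gr: "g k = r ^ nat \<bar>k\<bar>" for k
    by (simp add: g_def r_def flip: exp_of_nat_mult)
  have gsum: "(\<Sum>k\<in>{-int M..int M}. g k) \<le> 2 / (1 - r)" for M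
  proof -
    \<comment> \<open>The index 0 belongs to both halves; counting it twice only enlarges the bound,
      as \<open>g\<close> is nonnegative.\<close>
    have "(\<Sum>k\<in>{-int M..int M}. g k) \<le> (\<Sum>k\<in>int ` {..M} \<union> (\<lambda>n. - int n) ` {..M}. g k)"
    proof (rule sum_mono2)
      show "{-int M..int M} \<subseteq> int ` {..M} \<union> (\<lambda>n. - int n) ` {..M}"
      proof
        fix k assume "k \<in> {-int M..int M}"
        hence "nat \<bar>k\<bar> \<in> {..M}" "k = int (nat \<bar>k\<bar>) \<or> k = - int (nat \<bar>k\<bar>)" by auto
        thus "k \<in> int ` {..M} \<union> (\<lambda>n. - int n) ` {..M}" by blast
      qed
    qed (auto simp: g_def)
    also have "\<dots> \<le> (\<Sum>k\<in>int ` {..M}. g k) + (\<Sum>k\<in>(\<lambda>n. - int n) ` {..M}. g k)"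
      by (subst sum_Un) (auto simp: g_def intro!: sum_nonneg)
    also have "\<dots> = 2 * (\<Sum>n\<le>M. r ^ n)"
      by (subst (1 2) sum.reindex) (auto simp: inj_on_def gr)
    also have "(\<Sum>n\<le>M. r ^ n) \<le> 1 / (1 - r)"
    proof -
      have "(\<Sum>n\<le>M. r ^ n) = (1 - r ^ Suc M) / (1 - r)"
        using r by (simp add: sum_gp0)
      thus ?thesis using r by (simp add: divide_right_mono)
    qed
    finally show ?thesis by simp
  qed
  show "bdd_above (sum (\<lambda>b :: 'n \<Rightarrow>\<^sub>0 int. exp (- \<eta> * (\<Sum>i\<in>UNIV. \<bar>real_of_int (Poly_Mapping.lookup b i)\<bar>)))
      ` {F. F \<subseteq> UNIV \<and> finite F})"
  proof (rule bdd_aboveI2)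
    fix F :: "('n \<Rightarrow>\<^sub>0 int) set" assume "F \<in> {F. F \<subseteq> UNIV \<and> finite F}"
    hence F: "finite F" by simp
    define M where "M = Max (insert 0 ((\<lambda>(b, i). nat \<bar>Poly_Mapping.lookup b i\<bar>) ` (F \<times> UNIV)))"
    have M: "nat \<bar>Poly_Mapping.lookup b i\<bar> \<le> M" if "b \<in> F" for b i
      unfolding M_def using F that by (intro Max_ge) force+
    have M': "- int M \<le> Poly_Mapping.lookup b i \<and> Poly_Mapping.lookup b i \<le> int M" if "b \<in> F" for b i
      using M[OF that, of i] by linarith
    have "(\<Sum>b\<in>F. exp (- \<eta> * (\<Sum>i\<in>UNIV. \<bar>real_of_int (Poly_Mapping.lookup b i)\<bar>)))
        = (\<Sum>b\<in>F. \<Prod>i\<in>UNIV. g (Poly_Mapping.lookup b i))"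
      by (simp add: g_def sum_distrib_left exp_sum flip: sum_negf)
    also have "\<dots> = (\<Sum>h\<in>Poly_Mapping.lookup ` F. \<Prod>i\<in>UNIV. g (h i))"
      by (subst sum.reindex) (auto simp: inj_on_def)
    also have "\<dots> \<le> (\<Sum>h\<in>(UNIV :: 'n set) \<rightarrow>\<^sub>E {-int M..int M}. \<Prod>i\<in>UNIV. g (h i))"
    proof (rule sum_mono2)
      show "Poly_Mapping.lookup ` F \<subseteq> UNIV \<rightarrow>\<^sub>E {-int M..int M}"
        using M' by (simp add: PiE_UNIV_domain image_subset_iff)
    qed (auto intro!: finite_PiE prod_nonneg simp: g_def)
    also have "\<dots> = (\<Prod>i\<in>(UNIV :: 'n set). \<Sum>k\<in>{-int M..int M}. g k)"
      by (rule prod_sum_PiE[symmetric]) auto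
    also have "\<dots> \<le> (\<Prod>i\<in>(UNIV :: 'n set). 2 / (1 - r))"
      by (intro prod_mono conjI gsum sum_nonneg) (auto simp: g_def)
    finally show "(\<Sum>b\<in>F. exp (- \<eta> * (\<Sum>i\<in>UNIV. \<bar>real_of_int (Poly_Mapping.lookup b i)\<bar>)))
        \<le> (\<Prod>i\<in>(UNIV :: 'n set). 2 / (1 - r))" .
  qed
qed auto

text \<open>Write \<open>norm (x $ i)\<close> as the exponential of
  \<open>- l $ i + \<theta>\<close> with \<theta> at most \<eta> in absolute value: the monomial
  decays like \<open>exp (- (l \<bullet> lattice_point b))\<close> up to an error governed by the l1
  norm of \<open>b\<close>.\<close>

lemma norm_monom_eval_le:
  assumes x: "\<And>i. exp (- l $ i - \<eta>) < norm (x $ i)" "\<And>i. norm (x $ i) < exp (- l $ i + \<eta>)"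
  shows "norm (monom_eval x b) \<le>
    exp (- (l \<bullet> lattice_point b) + \<eta> * (\<Sum>i\<in>UNIV. \<bar>real_of_int (Poly_Mapping.lookup b i)\<bar>))"
proof -
  have "norm (monom_eval x b) = (\<Prod>i\<in>UNIV. norm (x $ i) powi Poly_Mapping.lookup b i)"
    by (simp add: monom_eval_def norm_power_int flip: prod_norm)
  also have "\<dots> \<le> (\<Prod>i\<in>UNIV. exp (- (l $ i * of_int (Poly_Mapping.lookup b i))
      + \<eta> * \<bar>real_of_int (Poly_Mapping.lookup b i)\<bar>))"
  proof (intro prod_mono conjI)
    fix i
    have pos: "norm (x $ i) > 0" by (rule less_trans[OF exp_gt_zero x(1)])
    define \<theta> where "\<theta> = ln (norm (x $ i)) + l $ i"
    have "ln (exp (- l $ i - \<eta>)) < ln (norm (x $ i))" "ln (norm (x $ i)) < ln (exp (- l $ i + \<eta>))"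
      by (simp_all only: ln_less_cancel_iff exp_gt_zero pos x)
    hence \<theta>: "\<bar>\<theta>\<bar> \<le> \<eta>" by (auto simp: \<theta>_def)
    have "norm (x $ i) powi Poly_Mapping.lookup b i =
        exp (of_int (Poly_Mapping.lookup b i) * ln (norm (x $ i)))"
      using pos exp_power_int[of "ln (norm (x $ i))" "Poly_Mapping.lookup b i"] by simp
    also have "of_int (Poly_Mapping.lookup b i) * ln (norm (x $ i)) =
        - (l $ i * of_int (Poly_Mapping.lookup b i)) + \<theta> * of_int (Poly_Mapping.lookup b i)"
      by (simp add: \<theta>_def algebra_simps)
    finally have "norm (x $ i) powi Poly_Mapping.lookup b i =
        exp (- (l $ i * of_int (Poly_Mapping.lookup b i)) + \<theta> * of_int (Poly_Mapping.lookup b i))" .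
    moreover have "\<theta> * real_of_int (Poly_Mapping.lookup b i) \<le> \<bar>\<theta>\<bar> * \<bar>real_of_int (Poly_Mapping.lookup b i)\<bar>"
      by (metis abs_ge_self abs_mult)
    moreover have "\<dots> \<le> \<eta> * \<bar>real_of_int (Poly_Mapping.lookup b i)\<bar>"
      using \<theta> by (intro mult_right_mono) auto
    ultimately show "norm (x $ i) powi Poly_Mapping.lookup b i \<le>
      exp (- (l $ i * of_int (Poly_Mapping.lookup b i)) + \<eta> * \<bar>real_of_int (Poly_Mapping.lookup b i)\<bar>)"
      by simp
  qed (simp add: zero_le_power_int)
  also have "\<dots> = exp (- (l \<bullet> lattice_point b) + \<eta> * (\<Sum>i\<in>UNIV. \<bar>real_of_int (Poly_Mapping.lookup b i)\<bar>))"
    by (subst exp_sum[symmetric])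
      (simp_all add: sum.distrib sum_negf sum_subtractf sum_distrib_left inner_vec_def lattice_point_def)
  finally show ?thesis .
qed

lemma cone_series_summable:
  fixes Q :: "(real ^ 'n::{finite,linorder}) set"
  assumes c: "c > 0" and l: "\<And>u. u \<in> Q \<Longrightarrow> c * norm u \<le> l \<bullet> u"
  obtains U where "open U" "U \<noteq> {}" "\<And>x i. x \<in> U \<Longrightarrow> x $ i \<noteq> 0"
    "\<And>x. x \<in> U \<Longrightarrow> monom_eval x summable_on {a. lattice_point a \<in> Q}"
proof -
  let ?n = "real CARD('n)"
  \<comment> \<open>The l1 norm is at most \<open>?n\<close> times the Euclidean one, so
    \<open>l\<close> is at least 2\<eta> times the l1 norm on \<open>Q\<close>. Half of this absorbs
    the freedom of \<open>x\<close> in an open set, the other half gives summability.\<close>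
  define \<eta> where "\<eta> = c / (2 * ?n)"
  have \<eta>: "\<eta> > 0" using c by (simp add: \<eta>_def)
  have l1: "2 * \<eta> * (\<Sum>i\<in>UNIV. \<bar>real_of_int (Poly_Mapping.lookup b i)\<bar>) \<le> l \<bullet> lattice_point b"
    if b: "lattice_point b \<in> Q" for b :: "'n \<Rightarrow>\<^sub>0 int"
  proof -
    have "(\<Sum>i\<in>UNIV. \<bar>real_of_int (Poly_Mapping.lookup b i)\<bar>) = (\<Sum>i\<in>UNIV. \<bar>lattice_point b $ i\<bar>)"
      by (simp add: lattice_point_def)
    also have "\<dots> \<le> ?n * norm (lattice_point b)"
      by (rule sum_bounded_above) (rule component_le_norm_cart)
    finally have "2 * \<eta> * (\<Sum>i\<in>UNIV. \<bar>real_of_int (Poly_Mapping.lookup b i)\<bar>)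
        \<le> 2 * \<eta> * (?n * norm (lattice_point b))" using \<eta> by (intro mult_left_mono) auto
    also have "\<dots> = c * norm (lattice_point b)" by (simp add: \<eta>_def)
    finally show ?thesis using l[OF b] by simp
  qed
  define U :: "(complex ^ 'n::{finite,linorder}) set" where
    "U = (\<Inter>i. {x. exp (- l $ i - \<eta>) < norm (x $ i)} \<inter> {x. norm (x $ i) < exp (- l $ i + \<eta>)})"
  show thesis
  proof (rule that[of U])
    show "open U" unfolding U_def
      by (intro open_INT open_Int ballI open_Collect_less continuous_intros) auto
    have "(\<chi> i. of_real (exp (- l $ i))) \<in> U" using \<eta> by (simp add: U_def)
    thus "U \<noteq> {}" by blast
    show "x $ i \<noteq> 0" if "x \<in> U" for x i
    proof -
      have "exp (- l $ i - \<eta>) < norm (x $ i)" using that by (simp add: U_def)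
      thus ?thesis by (smt (verit) exp_gt_zero norm_zero)
    qed
    show "monom_eval x summable_on {a. lattice_point a \<in> Q}" if x: "x \<in> U" for x
    proof (rule abs_summable_summable, rule Infinite_Sum.abs_summable_on_comparison_test')
      show "(\<lambda>b. exp (- \<eta> * (\<Sum>i\<in>UNIV. \<bar>real_of_int (Poly_Mapping.lookup b i)\<bar>)))
          summable_on {a. lattice_point a \<in> Q}"
        by (rule summable_on_subset_banach[OF summable_exp_l1[OF \<eta>]]) auto
      fix b assume "b \<in> {a. lattice_point a \<in> Q}"
      with l1[of b] have "- (l \<bullet> lattice_point b) + \<eta> * (\<Sum>i\<in>UNIV. \<bar>real_of_int (Poly_Mapping.lookup b i)\<bar>)
          \<le> - \<eta> * (\<Sum>i\<in>UNIV. \<bar>real_of_int (Poly_Mapping.lookup b i)\<bar>)" by simp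
      with norm_monom_eval_le[of l \<eta> x b] x
      show "norm (monom_eval x b) \<le> exp (- \<eta> * (\<Sum>i\<in>UNIV. \<bar>real_of_int (Poly_Mapping.lookup b i)\<bar>))"
        by (intro order_trans[OF norm_monom_eval_le]) (auto simp: U_def)
    qed
  qed
qed

section \<open>The rational function of a pointed cone\<close>

text \<open>Wherever the series converges with nonzero coordinates, \<open>q\<close> times its sum
  is the value of \<open>p\<close> (the fact \<open>key\<close>). This yields both existence and
  uniqueness of the rational function.\<close>

lemma gf_cone_eq:
  fixes Q :: "(real ^ 'n::{finite,linorder}) set"
  assumes c: "c > 0" and l: "\<And>u. u \<in> Q \<Longrightarrow> c * norm u \<le> l \<bullet> u" and ws: "0 \<notin> set ws"
    and p: "Poly_Mapping.lookup p = diffs ws (\<lambda>b. indicator Q (lattice_point b))"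
  shows "gf_cone Q = Fract p (binomial_prod ws)"
proof -
  let ?q = "binomial_prod ws"
  have q0: "?q \<noteq> 0" using ws by (rule binomial_prod_nonzero)
  have key: "laurent_eval p x = laurent_eval ?q x * s"
    if x: "\<forall>i. x $ i \<noteq> 0" and s: "(monom_eval x has_sum s) {a. lattice_point a \<in> Q}" for x s
  proof -
    have "((\<lambda>b. indicator Q (lattice_point b) * monom_eval x b) has_sum s) UNIV"
      using s by (subst has_sum_cong_neutral[where T = "{a. lattice_point a \<in> Q}" and g = "monom_eval x"])
        (auto simp: indicator_def)
    from has_sum_diffs[OF x this, of ws] show ?thesis
      unfolding laurent_eval_binomial_prod[OF x] by (intro laurent_eval_eqI) (simp add: p)
  qed
  obtain U where U: "open U" "U \<noteq> {}" "\<And>x i. x \<in> U \<Longrightarrow> x $ i \<noteq> 0"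
    "\<And>x. x \<in> U \<Longrightarrow> monom_eval x summable_on {a. lattice_point a \<in> Q}"
    using cone_series_summable[OF c l] by blast
  \<comment> \<open>\<open>?q\<close> may have zeros in \<open>U\<close>; removing them leaves a
    nonempty open set since \<open>?q\<close> is not the zero polynomial.\<close>
  define U' where "U' = U \<inter> laurent_eval ?q -` (- {0})"
  have "continuous_on U (laurent_eval ?q)"
    unfolding laurent_eval_def monom_eval_def using U(3)
    by (intro continuous_intros) auto
  hence U'1: "open U'" unfolding U'_def using U(1) by (intro continuous_open_preimage) auto
  have U'2: "U' \<noteq> {}"
    using laurent_eval_zero_imp_zero[OF U(1,2,3), of ?q] q0 by (auto simp: U'_def)
  have U'3: "(monom_eval x has_sum (laurent_eval p x / laurent_eval ?q x)) {a. lattice_point a \<in> Q}"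
    if x: "x \<in> U'" for x
  proof -
    obtain s where s: "(monom_eval x has_sum s) {a. lattice_point a \<in> Q}"
      using U(4) x by (auto simp: U'_def summable_on_def)
    have "laurent_eval p x = laurent_eval ?q x * s"
      by (rule key) (use U(3) s x in \<open>auto simp: U'_def\<close>)
    with s x show ?thesis by (simp add: U'_def)
  qed
  have "series_converges_to Q (Fract p ?q)"
    unfolding series_converges_to_def
  proof (rule exI[of _ U'], rule exI[of _ p], rule exI[of _ ?q], intro conjI ballI allI)
    show "x $ i \<noteq> 0" if "x \<in> U'" for x i
      using that U(3) by (auto simp: U'_def)
    show "laurent_eval ?q x \<noteq> 0" if "x \<in> U'" for x
      using that by (auto simp: U'_def)
    show "open U'" by (fact U'1)
    show "U' \<noteq> {}" by (fact U'2)
    show "?q \<noteq> 0" by (fact q0)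
  qed (rule refl, rule U'3)
  \<comment> \<open>The open set on which a rival \<open>R\<close> represents the series need not
    meet \<open>U\<close>; \<open>key\<close> holds there too, and cross-multiplication compares
    Laurent polynomials on that set alone.\<close>
  moreover have "R = Fract p ?q" if R: "series_converges_to Q R" for R
  proof -
    obtain V p' q' where conv: "open V \<and> V \<noteq> {} \<and> (\<forall>x\<in>V. \<forall>i. x $ i \<noteq> 0) \<and> q' \<noteq> 0 \<and> R = Fract p' q' \<and>
      (\<forall>x\<in>V. laurent_eval q' x \<noteq> 0 \<and>
        (monom_eval x has_sum (laurent_eval p' x / laurent_eval q' x)) {a. lattice_point a \<in> Q})"
      using R unfolding series_converges_to_def by blast
    hence V: "open V" "V \<noteq> {}" "\<And>x i. x \<in> V \<Longrightarrow> x $ i \<noteq> 0" "q' \<noteq> 0" "R = Fract p' q'"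
      "\<And>x. x \<in> V \<Longrightarrow> laurent_eval q' x \<noteq> 0"
      "\<And>x. x \<in> V \<Longrightarrow> (monom_eval x has_sum (laurent_eval p' x / laurent_eval q' x)) {a. lattice_point a \<in> Q}"
      by simp_all
    have "p' * ?q - p * q' = 0"
    proof (rule laurent_eval_zero_imp_zero[OF V(1,2,3)])
      fix x assume x: "x \<in> V"
      hence x0: "\<forall>i. x $ i \<noteq> 0" using V(3) by blast
      from key[OF x0 V(7)[OF x]] V(6)[OF x] show "laurent_eval (p' * ?q - p * q') x = 0"
        by (simp add: laurent_eval_minus laurent_eval_mult[OF x0])
    qed
    thus ?thesis using V(4,5) q0 by (simp add: eq_fract)
  qed
  ultimately show ?thesis unfolding gf_cone_def by (rule the_equality)
qed

section \<open>Finitely generated cones\<close>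

definition conic_comb :: "'a::real_vector set \<Rightarrow> 'a set" where
  "conic_comb W = {\<Sum>w\<in>W. t w *\<^sub>R w | t. \<forall>w\<in>W. 0 \<le> t w}"

lemma convex_cone_sum:
  assumes "convex_cone K" "\<And>i. i \<in> I \<Longrightarrow> f i \<in> K"
  shows "sum f I \<in> K"
  using assms(2)
  by (induction I rule: infinite_finite_induct)
    (auto simp: convex_cone_contains_0[OF assms(1)] convex_cone_add[OF assms(1)])

lemma conic_comb_eq_hull:
  assumes "finite W"
  shows "conic_comb W = convex_cone hull W"
proof
  have K: "convex_cone (convex_cone hull W)" by (rule convex_cone_convex_cone_hull)
  have "(\<Sum>w\<in>W. t w *\<^sub>R w) \<in> convex_cone hull W" if "\<forall>w\<in>W. 0 \<le> t w" for t
    using that by (intro convex_cone_sum[OF K] convex_cone_scaleR[OF K]) (auto intro: hull_inc)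
  thus "conic_comb W \<subseteq> convex_cone hull W" unfolding conic_comb_def by blast
  show "convex_cone hull W \<subseteq> conic_comb W"
  proof (rule hull_minimal)
    show "W \<subseteq> conic_comb W"
    proof
      fix w assume "w \<in> W"
      hence "w = (\<Sum>v\<in>W. (if v = w then 1 else 0 :: real) *\<^sub>R v)"
        using assms by (simp add: if_distrib[of "\<lambda>x. x *\<^sub>R _"] sum.delta cong: if_cong)
      moreover have "\<forall>v\<in>W. 0 \<le> (if v = w then 1 else 0 :: real)" by simp
      ultimately show "w \<in> conic_comb W" unfolding conic_comb_def
        by (intro CollectI exI[of _ "\<lambda>v. if v = w then 1 else 0"] conjI)
    qed
    show "convex_cone (conic_comb W)" unfolding convex_cone_iff
    proof (intro conjI ballI allI impI)
      show "0 \<in> conic_comb W" unfolding conic_comb_def by (auto intro!: exI[of _ "\<lambda>_. 0"])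
      show "x + y \<in> conic_comb W" if xy: "x \<in> conic_comb W" "y \<in> conic_comb W" for x y
      proof -
        from xy obtain s t where "x = (\<Sum>w\<in>W. s w *\<^sub>R w)" "\<forall>w\<in>W. 0 \<le> s w"
          "y = (\<Sum>w\<in>W. t w *\<^sub>R w)" "\<forall>w\<in>W. 0 \<le> t w" by (auto simp: conic_comb_def)
        thus ?thesis unfolding conic_comb_def
          by (intro CollectI exI[of _ "\<lambda>w. s w + t w"]) (auto simp: scaleR_add_left sum.distrib)
      qed
      show "c *\<^sub>R x \<in> conic_comb W" if x: "x \<in> conic_comb W" and c: "0 \<le> c" for x c
      proof -
        from x obtain s where "x = (\<Sum>w\<in>W. s w *\<^sub>R w)" "\<forall>w\<in>W. 0 \<le> s w"
          by (auto simp: conic_comb_def)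
        thus ?thesis using c unfolding conic_comb_def
          by (intro CollectI exI[of _ "\<lambda>w. c * s w"]) (auto simp: scaleR_sum_right)
      qed
    qed
  qed
qed

lemma convex_cone_conic_comb: "finite W \<Longrightarrow> convex_cone (conic_comb W)"
  by (simp add: conic_comb_eq_hull convex_cone_convex_cone_hull)

lemma cone_conic_comb: "finite W \<Longrightarrow> cone (conic_comb W)"
  by (simp add: cone_def convex_cone_scaleR[OF convex_cone_conic_comb])

lemma conic_comb_inc: "finite W \<Longrightarrow> w \<in> W \<Longrightarrow> w \<in> conic_comb W"
  by (simp add: conic_comb_eq_hull hull_inc)

lemma conic_comb_minus_0:
  assumes "finite W" shows "conic_comb (W - {0}) = conic_comb W"
proof
  show "conic_comb (W - {0}) \<subseteq> conic_comb W"
    using assms by (simp add: conic_comb_eq_hull hull_mono)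
  show "conic_comb W \<subseteq> conic_comb (W - {0})"
  proof
    fix x assume "x \<in> conic_comb W"
    then obtain s where s: "x = (\<Sum>w\<in>W. s w *\<^sub>R w)" "\<forall>w\<in>W. 0 \<le> s w"
      by (auto simp: conic_comb_def)
    have "x = (\<Sum>w\<in>W - {0}. s w *\<^sub>R w)"
      unfolding s(1) using assms by (intro sum.mono_neutral_right) auto
    thus "x \<in> conic_comb (W - {0})" using s(2) unfolding conic_comb_def by blast
  qed
qed

lemma finite_halfspaces_polyhedron:
  assumes "polyhedron S"
  shows "finite_halfspaces S"
proof -
  obtain F where F: "finite F" "S = \<Inter>F" "\<forall>h\<in>F. \<exists>a b. a \<noteq> 0 \<and> h = {x. a \<bullet> x \<le> b}"
    using assms unfolding polyhedron_def by blast
  then obtain a b where ab: "\<And>h. h \<in> F \<Longrightarrow> h = {x. a h \<bullet> x \<le> b h}" by metis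
  have "S = {x. \<forall>h\<in>F. a h \<bullet> x \<le> b h}" unfolding F(2) using ab by blast
  hence "S = {x. \<forall>(a, b)\<in>(\<lambda>h. (a h, b h)) ` F. a \<bullet> x \<le> b}" by simp
  with F(1) show ?thesis unfolding finite_halfspaces_def by blast
qed

text \<open>Weyl's half of the Minkowski-Weyl theorem.\<close>

lemma finite_halfspaces_conic_comb:
  fixes W :: "'a::euclidean_space set"
  shows "finite W \<Longrightarrow> finite_halfspaces (conic_comb W)"
  by (simp add: conic_comb_eq_hull finite_halfspaces_polyhedron polyhedron_convex_cone_hull)

text \<open>A nonzero \<open>u\<close> has a generator with positive coefficient; removing that
  term, or doubling it, stays in the cone.\<close>

lemma movable_conic_comb:
  assumes W: "finite W" "W - {0} \<subseteq> set ws" and u: "u \<in> conic_comb W" "u \<noteq> 0"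
  shows "movable ws (conic_comb W) u"
proof -
  obtain t where t: "u = (\<Sum>w\<in>W. t w *\<^sub>R w)" "\<forall>w\<in>W. 0 \<le> t w"
    using u by (auto simp: conic_comb_def)
  obtain w where w: "w \<in> W" "t w *\<^sub>R w \<noteq> 0" using u(2) unfolding t(1) by (meson sum.neutral)
  have tw: "t w > 0" using w t(2) by (metis less_eq_real_def scaleR_zero_left)
  have "u - t w *\<^sub>R w = (\<Sum>v\<in>W - {w}. t v *\<^sub>R v)"
    unfolding t(1) using W(1) w(1) by (simp add: sum.remove)
  also have "\<dots> \<in> conic_comb W"
    by (rule convex_cone_sum[OF convex_cone_conic_comb[OF W(1)]])
      (use t(2) W(1) in \<open>simp add: convex_cone_scaleR[OF convex_cone_conic_comb] conic_comb_inc\<close>)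
  finally have "u - t w *\<^sub>R w \<in> conic_comb W" .
  moreover have "u + t w *\<^sub>R w \<in> conic_comb W"
    using convex_cone_conic_comb[OF W(1)] u(1) conic_comb_inc[OF W(1) w(1)] tw
    by (simp add: convex_cone_add convex_cone_scaleR)
  moreover have "w \<in> set ws" using w W(2) by auto
  ultimately show ?thesis unfolding movable_def using tw by blast
qed

text \<open>If 0 were a convex combination of generators, solving for a term of positive weight
  would put some \<open>- w\<close> in the cone. So a hyperplane separates 0 from the compact hull:
  \<open>l\<close> exceeds \<open>b\<close> on generators, their norms are at most \<open>M\<close>,
  and \<open>b / M\<close> works by comparing coefficients.\<close>

lemma pointed_cone_functional:
  fixes W :: "'a::euclidean_space set"
  assumes W: "finite W" "0 \<notin> W" and neg: "\<And>w. w \<in> W \<Longrightarrow> - w \<notin> conic_comb W"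
  obtains l c where "c > 0" "\<And>u. u \<in> conic_comb W \<Longrightarrow> c * norm u \<le> l \<bullet> u"
proof -
  have "0 \<notin> convex hull W"
  proof
    assume "0 \<in> convex hull W"
    then obtain m where m: "\<forall>w\<in>W. 0 \<le> m w" "sum m W = 1" "(\<Sum>w\<in>W. m w *\<^sub>R w) = 0"
      using convex_hull_finite[OF W(1)] by auto
    obtain w where w: "w \<in> W" "m w \<noteq> 0" using m(2) by (metis sum.neutral zero_neq_one)
    have "m w > 0" using w m(1) by force
    have "m w *\<^sub>R w + (\<Sum>v\<in>W - {w}. m v *\<^sub>R v) = 0"
      using m(3) W(1) w(1) by (simp add: sum.remove)
    hence "(\<Sum>v\<in>W - {w}. m v *\<^sub>R v) = m w *\<^sub>R (- w)"
      by (metis add.commute eq_neg_iff_add_eq_0 scaleR_minus_right)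
    moreover have "(\<Sum>v\<in>W - {w}. m v *\<^sub>R v) \<in> conic_comb W"
      by (rule convex_cone_sum[OF convex_cone_conic_comb[OF W(1)]])
        (use m(1) W(1) in \<open>simp add: convex_cone_scaleR[OF convex_cone_conic_comb] conic_comb_inc\<close>)
    ultimately have "m w *\<^sub>R (- w) \<in> conic_comb W" by simp
    hence "(1 / m w) *\<^sub>R m w *\<^sub>R (- w) \<in> conic_comb W"
      using \<open>m w > 0\<close> by (rule_tac convex_cone_scaleR[OF convex_cone_conic_comb[OF W(1)]]) simp_all
    moreover have "(1 / m w) *\<^sub>R m w *\<^sub>R (- w) = - w" using \<open>m w > 0\<close> by simp
    ultimately show False using neg[OF w(1)] by metis
  qed
  moreover have "closed (convex hull W)"
    using W(1) by (simp add: finite_imp_compact_convex_hull compact_imp_closed)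
  ultimately obtain l b where lb: "0 < b" "\<And>x. x \<in> convex hull W \<Longrightarrow> l \<bullet> x > b"
    using separating_hyperplane_closed_0[of "convex hull W"] by (metis convex_convex_hull)
  \<comment> \<open>The summand 1 keeps \<open>M\<close> positive even when there are no
    generators.\<close>
  define M where "M = 1 + (\<Sum>w\<in>W. norm w)"
  have M: "norm w \<le> M" if "w \<in> W" for w
    using member_le_sum[OF that, of norm] W(1) by (simp add: M_def)
  have M0: "M > 0" unfolding M_def by (simp add: add_pos_nonneg sum_nonneg)
  show thesis
  proof (rule that[of "b / M" l])
    show "b / M > 0" using lb(1) M0 by simp
    fix u assume "u \<in> conic_comb W"
    then obtain t where t: "u = (\<Sum>w\<in>W. t w *\<^sub>R w)" "\<forall>w\<in>W. 0 \<le> t w"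
      by (auto simp: conic_comb_def)
    have "norm u \<le> (\<Sum>w\<in>W. norm (t w *\<^sub>R w))" unfolding t(1) by (rule norm_sum)
    also have "\<dots> \<le> (\<Sum>w\<in>W. t w * M)"
      using t(2) M by (intro sum_mono) (simp add: mult_left_mono)
    finally have "b / M * norm u \<le> b / M * (\<Sum>w\<in>W. t w * M)"
      using lb(1) M0 by (intro mult_left_mono) auto
    also have "\<dots> = (\<Sum>w\<in>W. t w * b)" using M0 by (simp add: sum_distrib_left mult.commute)
    also have "\<dots> \<le> (\<Sum>w\<in>W. t w * (l \<bullet> w))"
      using t(2) lb(2)[OF hull_inc] by (intro sum_mono mult_left_mono) (auto intro: less_imp_le)
    also have "\<dots> = l \<bullet> u" by (simp add: t(1) inner_sum_right)
    finally show "b / M * norm u \<le> l \<bullet> u" .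
  qed
qed

text \<open>Homogenization: the set is the slice at height \<open>1\<close> of a finitely generated cone.\<close>

lemma finite_halfspaces_hull_plus_cone:
  fixes E V :: "'a::euclidean_space set"
  assumes E: "finite E" and V: "finite V"
  shows "finite_halfspaces {e + c | e c. e \<in> convex hull E \<and> c \<in> conic_comb V}"
proof -
  define W where "W = (\<lambda>e. (e, 1 :: real)) ` E \<union> (\<lambda>v. (v, 0)) ` V"
  \<comment> \<open>The last coordinate records the total weight of the part from \<open>E\<close>;
    at height 1 that part is a convex combination.\<close>
  define K' where "K' = {((\<Sum>a\<in>E. t a *\<^sub>R a) + c, \<Sum>a\<in>E. t a) | t c.
    (\<forall>a\<in>E. 0 \<le> t a) \<and> c \<in> conic_comb V}"
  have W: "finite W" using E V by (simp add: W_def)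
  have CV: "convex_cone (conic_comb V)" using V by (rule convex_cone_conic_comb)
  have CK: "convex_cone (conic_comb W)" using W by (rule convex_cone_conic_comb)
  have "convex_cone hull W \<subseteq> K'"
  proof (rule hull_minimal)
    show "W \<subseteq> K'" unfolding W_def
    proof (intro Un_least image_subsetI)
      fix e assume e: "e \<in> E"
      have "(\<Sum>a\<in>E. (if a = e then 1 else 0 :: real) *\<^sub>R a) = e"
        "(\<Sum>a\<in>E. (if a = e then 1 else 0 :: real)) = 1"
        using E e by (simp_all add: if_distrib[of "\<lambda>x. x *\<^sub>R _"] sum.delta cong: if_cong)
      thus "(e, 1) \<in> K'" unfolding K'_def using convex_cone_contains_0[OF CV]
        by (intro CollectI exI[of _ "\<lambda>a. if a = e then 1 else 0"] exI[of _ 0]) auto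
    next
      fix v assume "v \<in> V"
      thus "(v, 0) \<in> K'" unfolding K'_def using conic_comb_inc[OF V]
        by (intro CollectI exI[of _ "\<lambda>_. 0"] exI[of _ v]) auto
    qed
    show "convex_cone K'" unfolding convex_cone_iff
    proof (intro conjI ballI allI impI)
      show "0 \<in> K'" unfolding K'_def using convex_cone_contains_0[OF CV]
        by (intro CollectI exI[of _ "\<lambda>_. 0"] exI[of _ 0]) (auto simp: zero_prod_def)
    next
      fix x y assume "x \<in> K'" "y \<in> K'"
      then obtain s c t d where "x = ((\<Sum>a\<in>E. s a *\<^sub>R a) + c, \<Sum>a\<in>E. s a)"
        "\<forall>a\<in>E. 0 \<le> s a" "c \<in> conic_comb V" "y = ((\<Sum>a\<in>E. t a *\<^sub>R a) + d, \<Sum>a\<in>E. t a)"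
        "\<forall>a\<in>E. 0 \<le> t a" "d \<in> conic_comb V" unfolding K'_def by blast
      thus "x + y \<in> K'" unfolding K'_def
        by (intro CollectI exI[of _ "\<lambda>a. s a + t a"] exI[of _ "c + d"])
          (auto simp: scaleR_add_left sum.distrib convex_cone_add[OF CV])
    next
      fix x and k :: real assume "x \<in> K'" "0 \<le> k"
      moreover from this obtain s c where "x = ((\<Sum>a\<in>E. s a *\<^sub>R a) + c, \<Sum>a\<in>E. s a)"
        "\<forall>a\<in>E. 0 \<le> s a" "c \<in> conic_comb V" unfolding K'_def by blast
      ultimately show "k *\<^sub>R x \<in> K'" unfolding K'_def
        by (intro CollectI exI[of _ "\<lambda>a. k * s a"] exI[of _ "k *\<^sub>R c"])
          (auto simp: scaleR_add_right scaleR_sum_right sum_distrib_left convex_cone_scaleR[OF CV])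
    qed
  qed
  hence KK: "conic_comb W \<subseteq> K'" using W by (simp add: conic_comb_eq_hull)
  have mem: "x \<in> {e + c | e c. e \<in> convex hull E \<and> c \<in> conic_comb V} \<longleftrightarrow> (x, 1) \<in> conic_comb W" for x
  proof
    assume "(x, 1) \<in> conic_comb W"
    hence "(x, 1) \<in> K'" using KK by blast
    then obtain t c where t: "x = (\<Sum>a\<in>E. t a *\<^sub>R a) + c" "(\<Sum>a\<in>E. t a) = 1"
      "\<forall>a\<in>E. 0 \<le> t a" "c \<in> conic_comb V" unfolding K'_def by auto
    have "(\<Sum>a\<in>E. t a *\<^sub>R a) \<in> convex hull E" using t(2,3) convex_hull_finite[OF E] by blast
    with t(1,4) show "x \<in> {e + c | e c. e \<in> convex hull E \<and> c \<in> conic_comb V}" by blast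
  next
    assume "x \<in> {e + c | e c. e \<in> convex hull E \<and> c \<in> conic_comb V}"
    then obtain e c where x: "x = e + c" "e \<in> convex hull E" "c \<in> conic_comb V" by blast
    obtain t where t: "\<forall>a\<in>E. 0 \<le> t a" "sum t E = 1" "e = (\<Sum>a\<in>E. t a *\<^sub>R a)"
      using x(2) convex_hull_finite[OF E] by auto
    obtain s where s: "c = (\<Sum>v\<in>V. s v *\<^sub>R v)" "\<forall>v\<in>V. 0 \<le> s v"
      using x(3) by (auto simp: conic_comb_def)
    have "(x, 1 :: real) = (\<Sum>a\<in>E. t a *\<^sub>R (a, 1)) + (\<Sum>v\<in>V. s v *\<^sub>R (v, 0))"
      using t(2) by (simp add: x(1) t(3) s(1) prod_eq_iff fst_sum snd_sum)
    also have "\<dots> \<in> conic_comb W"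
    proof (intro convex_cone_add[OF CK] convex_cone_sum[OF CK] convex_cone_scaleR[OF CK])
      show "(a, 1) \<in> conic_comb W" if "a \<in> E" for a
        using conic_comb_inc[OF W] that by (auto simp: W_def)
      show "(v, 0) \<in> conic_comb W" if "v \<in> V" for v
        using conic_comb_inc[OF W] that by (auto simp: W_def)
    qed (use t s in auto)
    finally show "(x, 1) \<in> conic_comb W" .
  qed
  obtain F where F: "finite F" "conic_comb W = {z. \<forall>(a, b)\<in>F. a \<bullet> z \<le> b}"
    using finite_halfspaces_conic_comb[OF W] unfolding finite_halfspaces_def by blast
  \<comment> \<open>With the last coordinate fixed to 1, its coefficient moves to the right-hand
    side of the constraint.\<close>
  have "(x, 1) \<in> conic_comb W \<longleftrightarrow>
      (\<forall>(a, b)\<in>(\<lambda>p. (fst (fst p), snd p - snd (fst p))) ` F. a \<bullet> x \<le> b)" for x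
    unfolding F(2) by (auto simp: inner_prod_def algebra_simps)
  hence "{e + c | e c. e \<in> convex hull E \<and> c \<in> conic_comb V} =
      {x. \<forall>(a, b)\<in>(\<lambda>p. (fst (fst p), snd p - snd (fst p))) ` F. a \<bullet> x \<le> b}"
    using mem by blast
  thus ?thesis unfolding finite_halfspaces_def using F(1) by blast
qed

section \<open>Convex sets with bounded complement in a cone\<close>

text \<open>The bound makes sublevel sets of \<open>l\<close> compact, so \<open>l\<close> attains
  its minimum over \<Delta>. The minimizers form a compact face, which has an extreme point, and
  extreme points of a face are extreme in the whole set.\<close>

lemma minimizing_extreme_point:
  fixes \<Delta> :: "'a::euclidean_space set"
  assumes \<Delta>: "closed \<Delta>" "convex \<Delta>" and x: "x \<in> \<Delta>"
    and k: "k > 0" "\<And>u. u \<in> \<Delta> \<Longrightarrow> k * norm u \<le> l \<bullet> u"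
  obtains e where "e extreme_point_of \<Delta>" "l \<bullet> e \<le> l \<bullet> x"
proof -
  have comp: "compact (\<Delta> \<inter> {y. l \<bullet> y \<le> b})" for b
  proof -
    have "norm u \<le> b / k" if "u \<in> \<Delta> \<inter> {y. l \<bullet> y \<le> b}" for u
      using k(2)[of u] that k(1) by (simp add: pos_le_divide_eq mult.commute)
    thus ?thesis using \<Delta>(1) by (auto simp: compact_eq_bounded_closed bounded_iff
          intro!: closed_Int closed_halfspace_le)
  qed
  have "\<Delta> \<inter> {y. l \<bullet> y \<le> l \<bullet> x} \<noteq> {}" using x by blast
  moreover have "continuous_on (\<Delta> \<inter> {y. l \<bullet> y \<le> l \<bullet> x}) (\<lambda>y. l \<bullet> y)" by (intro continuous_intros)
  ultimately obtain y where y: "y \<in> \<Delta> \<inter> {y. l \<bullet> y \<le> l \<bullet> x}"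
    "\<And>z. z \<in> \<Delta> \<inter> {y. l \<bullet> y \<le> l \<bullet> x} \<Longrightarrow> l \<bullet> y \<le> l \<bullet> z"
    using continuous_attains_inf[OF comp] by blast
  have min: "l \<bullet> y \<le> l \<bullet> z" if "z \<in> \<Delta>" for z
    using y that by (cases "l \<bullet> z \<le> l \<bullet> x") auto
  define F where "F = \<Delta> \<inter> {z. l \<bullet> z = l \<bullet> y}"
  have face: "F face_of \<Delta>"
    unfolding F_def by (intro face_of_Int_supporting_hyperplane_ge \<Delta>(2) min)
  have "F = (\<Delta> \<inter> {z. l \<bullet> z \<le> l \<bullet> y}) \<inter> {z. l \<bullet> z = l \<bullet> y}" unfolding F_def by auto
  hence "compact F" using comp by (metis closed_hyperplane compact_Int_closed)
  moreover have "convex F" using face face_of_imp_convex by blast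
  moreover have "F \<noteq> {}" using y by (auto simp: F_def)
  ultimately obtain e where e: "e extreme_point_of F" using extreme_point_exists_convex by blast
  hence "e extreme_point_of \<Delta>" "e \<in> F" using extreme_point_of_face[OF face] by auto
  moreover have "l \<bullet> e \<le> l \<bullet> x" using \<open>e \<in> F\<close> y(1) by (simp add: F_def)
  ultimately show thesis using that by blast
qed

section \<open>Vertices, recession and tangent cones of the complement\<close>

text \<open>Integrality is kept out of the geometry; it later enters through the assumption
  \<open>finite E\<close> of the individual facts.\<close>

locale cocompact_convex =
  fixes C \<Delta> :: "'a::euclidean_space set" and V :: "'a set"
  assumes V: "finite V" and C: "C = conic_comb V"
    and pointed: "\<And>w. w \<in> C \<Longrightarrow> - w \<in> C \<Longrightarrow> w = 0"
    and closed: "closed \<Delta>" and convex: "convex \<Delta>" and sub: "\<Delta> \<subseteq> C"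
    and bdd: "bounded (C - \<Delta>)"
begin

definition E where "E = {a. a extreme_point_of \<Delta>}"

lemma CC: "convex_cone C" unfolding C using V by (rule convex_cone_conic_comb)

lemma far: obtains B where "B > 0" "\<And>x. x \<in> C \<Longrightarrow> norm x \<ge> B \<Longrightarrow> x \<in> \<Delta>"
proof -
  obtain B where B: "\<And>x. x \<in> C - \<Delta> \<Longrightarrow> norm x \<le> B" using bdd by (auto simp: bounded_iff)
  show thesis by (rule that[of "\<bar>B\<bar> + 1"]) (use B in force)+
qed

text \<open>For large \<open>k\<close> the point \<open>k\<close> times \<open>c\<close> lies beyond
  the bounded complement, hence in \<Delta>. The segment from \<open>x\<close> to it contains
  \<open>x + c - x / k\<close>, which tends to \<open>x + c\<close>; closedness concludes.\<close>

lemma recession: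
  assumes x: "x \<in> \<Delta>" and c: "c \<in> C"
  shows "x + c \<in> \<Delta>"
proof (cases "c = 0")
  case False
  obtain B where B: "B > 0" "\<And>x. x \<in> C \<Longrightarrow> norm x \<ge> B \<Longrightarrow> x \<in> \<Delta>" using far by blast
  have "((\<lambda>n. (x + c) - (1 / real (Suc n)) *\<^sub>R x) \<longlongrightarrow> (x + c) - 0 *\<^sub>R x) sequentially"
    by (intro tendsto_intros LIMSEQ_Suc[OF lim_1_over_n])
  moreover have "eventually (\<lambda>n. (x + c) - (1 / real (Suc n)) *\<^sub>R x \<in> \<Delta>) sequentially"
  proof -
    obtain n0 :: nat where n0: "real n0 > B / norm c" using reals_Archimedean2 by blast
    have "(x + c) - (1 / real (Suc n)) *\<^sub>R x \<in> \<Delta>" if n: "n \<ge> n0" for n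
    proof -
      let ?k = "real (Suc n)"
      have "B / norm c \<le> ?k" using n0 n by simp
      hence "B \<le> norm (?k *\<^sub>R c)" using False by (simp add: pos_divide_le_eq)
      moreover have "?k *\<^sub>R c \<in> C" using CC c by (intro convex_cone_scaleR) auto
      ultimately have "?k *\<^sub>R c \<in> \<Delta>" using B by blast
      hence "(1 - 1 / ?k) *\<^sub>R x + (1 / ?k) *\<^sub>R (?k *\<^sub>R c) \<in> \<Delta>"
        using x by (intro convexD[OF convex]) auto
      moreover have "(1 - 1 / ?k) *\<^sub>R x + (1 / ?k) *\<^sub>R (?k *\<^sub>R c) = (x + c) - (1 / ?k) *\<^sub>R x"
        by (simp add: scaleR_diff_left del: of_nat_Suc)
      ultimately show ?thesis by (simp only:)
    qed
    thus ?thesis unfolding eventually_sequentially by blast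
  qed
  ultimately have "(x + c) - 0 *\<^sub>R x \<in> \<Delta>"
    by (intro Lim_in_closed_set[OF closed _ _, of _ sequentially]) auto
  thus ?thesis by simp
qed (use x in simp)

text \<open>A vertex of norm above \<open>2 * B\<close> would be the midpoint of its multiples by
  1/2 and 3/2, both of norm at least \<open>B\<close> and therefore in \<Delta>.\<close>

lemma bounded_E: "bounded E"
proof -
  obtain B where B: "B > 0" "\<And>x. x \<in> C \<Longrightarrow> norm x \<ge> B \<Longrightarrow> x \<in> \<Delta>" using far by blast
  have "norm a \<le> 2 * B" if a: "a extreme_point_of \<Delta>" for a
  proof (rule ccontr)
    assume n: "\<not> norm a \<le> 2 * B"
    hence "a \<noteq> 0" using B by auto
    have aC: "a \<in> C" using a sub by (auto simp: extreme_point_of_def)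
    have "(1 / 2) *\<^sub>R a \<in> \<Delta>" "(3 / 2) *\<^sub>R a \<in> \<Delta>"
      using n B aC by (auto intro!: B(2) convex_cone_scaleR[OF CC])
    moreover have "a \<in> open_segment ((1 / 2) *\<^sub>R a) ((3 / 2) *\<^sub>R a)"
    proof -
      have "a = (1 - 1 / 2) *\<^sub>R (1 / 2) *\<^sub>R a + (1 / 2) *\<^sub>R (3 / 2) *\<^sub>R a"
        by (simp flip: scaleR_add_left)
      moreover have "(1 / 2) *\<^sub>R a \<noteq> (3 / 2) *\<^sub>R a" using \<open>a \<noteq> 0\<close> by simp
      ultimately show ?thesis unfolding in_segment
        by (intro conjI exI[of _ "1 / 2"]) auto
    qed
    ultimately show False using a unfolding extreme_point_of_def by blast
  qed
  thus ?thesis unfolding bounded_iff E_def by blast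
qed

lemma C_functional:
  obtains l c where "c > 0" "\<And>u. u \<in> C \<Longrightarrow> c * norm u \<le> l \<bullet> u"
proof -
  have eq: "conic_comb (V - {0}) = C" using V C by (simp add: conic_comb_minus_0)
  show thesis
  proof (rule pointed_cone_functional[of "V - {0}"])
    show "- w \<notin> conic_comb (V - {0})" if "w \<in> V - {0}" for w
    proof -
      have "w \<in> C" using that V by (simp add: C conic_comb_inc)
      thus ?thesis using pointed[of w] that unfolding eq by blast
    qed
  qed (use V that in \<open>auto simp: eq\<close>)
qed

text \<open>A functional \<open>a\<close> separating a stray \<open>x\<close> from the closed sum is
  nonnegative on \<open>C\<close>, but its minimum over \<Delta> need not be attained. Adding a
  small multiple of a functional positive on \<open>C\<close> repairs this: some vertex then has
  value at most that of \<open>x\<close>, although vertices lie on the other side.\<close>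

lemma decomposition:
  assumes E: "finite E"
  shows "\<Delta> = {e + c | e c. e \<in> convex hull E \<and> c \<in> C}"
proof
  have "convex hull E \<subseteq> \<Delta>" using convex
    by (intro hull_minimal) (auto simp: E_def extreme_point_of_def)
  thus "{e + c | e c. e \<in> convex hull E \<and> c \<in> C} \<subseteq> \<Delta>" using recession by blast
  show "\<Delta> \<subseteq> {e + c | e c. e \<in> convex hull E \<and> c \<in> C}" (is "_ \<subseteq> ?M")
  proof (rule ccontr)
    assume "\<not> \<Delta> \<subseteq> ?M"
    then obtain x where x: "x \<in> \<Delta>" "x \<notin> ?M" by blast
    obtain l k where l: "k > 0" "\<And>u. u \<in> C \<Longrightarrow> k * norm u \<le> l \<bullet> u" using C_functional by blast
    have lpos: "l \<bullet> u \<ge> 0" if "u \<in> C" for u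
      using l(2)[OF that] l(1) by (meson mult_nonneg_nonneg less_imp_le norm_ge_zero order_trans)
    have EM: "e \<in> ?M" if "e \<in> E" for e
    proof -
      have "e = e + 0" "e \<in> convex hull E" "0 \<in> C"
        using that convex_cone_contains_0[OF CC] by (auto intro: hull_inc)
      thus ?thesis by blast
    qed
    have sums: "?M = (\<Union>x\<in>convex hull E. \<Union>y\<in>C. {x + y})" by blast
    have "closed C" unfolding C using finite_halfspaces_conic_comb[OF V] by (rule finite_halfspaces_closed)
    moreover have "compact (convex hull E)" using E by (rule finite_imp_compact_convex_hull)
    ultimately have "closed ?M" using compact_closed_sums[of "convex hull E" C] unfolding sums by blast
    moreover have "convex ?M"
      using convex_sums[of "convex hull E" C] CC unfolding sums by (simp add: convex_cone_def)
    ultimately obtain a b where ab: "a \<bullet> x < b" "\<And>m. m \<in> ?M \<Longrightarrow> a \<bullet> m > b"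
      using separating_hyperplane_closed_point[of ?M x] x(2) by blast
    \<comment> \<open>A vertex is required as the starting point of the rays along which a negative
      value of \<open>a\<close> on \<open>C\<close> would be contradictory.\<close>
    obtain e0 where e0: "e0 \<in> E"
      using minimizing_extreme_point[OF closed convex x(1) l(1), of l] l(2) sub
      unfolding E_def by (metis mem_Collect_eq subsetD)
    have apos: "a \<bullet> c \<ge> 0" if c: "c \<in> C" for c
    proof (rule ccontr)
      assume neg: "\<not> a \<bullet> c \<ge> 0"
      define s where "s = (b - a \<bullet> e0) / (a \<bullet> c)"
      have "s \<ge> 0" using neg ab(2)[OF EM[OF e0]] by (simp add: s_def divide_nonpos_neg)
      hence "e0 + s *\<^sub>R c \<in> ?M" using c e0 hull_inc[of e0 E] convex_cone_scaleR[OF CC] by blast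
      hence "a \<bullet> (e0 + s *\<^sub>R c) > b" by (rule ab(2))
      moreover have "a \<bullet> (e0 + s *\<^sub>R c) = b" using neg by (simp add: s_def inner_add_right)
      ultimately show False by simp
    qed
    define d where "d = 1 + \<bar>l \<bullet> x\<bar>"
    have d: "d > 0" "l \<bullet> x \<le> d" by (auto simp: d_def)
    \<comment> \<open>The perturbation spends at most half of the gap between
      \<open>a \<bullet> x\<close> and \<open>b\<close>; \<open>d\<close> is a positive upper bound
      of \<open>l \<bullet> x\<close>.\<close>
    define \<eta> where "\<eta> = (b - a \<bullet> x) / (2 * d)"
    have \<eta>: "\<eta> > 0" using ab(1) d by (simp add: \<eta>_def)
    have "\<eta> * (l \<bullet> x) \<le> \<eta> * d" using \<eta> d by (intro mult_left_mono) auto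
    also have "\<dots> = (b - a \<bullet> x) / 2" using d by (simp add: \<eta>_def)
    finally have ax: "(a + \<eta> *\<^sub>R l) \<bullet> x < b" using ab(1) by (simp add: inner_add_left)
    have "(\<eta> * k) * norm u \<le> (a + \<eta> *\<^sub>R l) \<bullet> u" if "u \<in> \<Delta>" for u
    proof -
      have u: "u \<in> C" using that sub by blast
      have "\<eta> * (k * norm u) \<le> \<eta> * (l \<bullet> u)" using l(2)[OF u] \<eta> by simp
      thus ?thesis using apos[OF u] by (simp add: inner_add_left)
    qed
    moreover have "\<eta> * k > 0" using \<eta> l(1) by simp
    ultimately obtain e where e: "e extreme_point_of \<Delta>" "(a + \<eta> *\<^sub>R l) \<bullet> e \<le> (a + \<eta> *\<^sub>R l) \<bullet> x"
      using minimizing_extreme_point[OF closed convex x(1)] by metis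
    have "a \<bullet> e > b" using ab(2) EM e(1) by (simp add: E_def)
    moreover have "e \<in> C" using e(1) sub by (auto simp: extreme_point_of_def)
    moreover from this have "0 \<le> \<eta> * (l \<bullet> e)" using lpos \<eta> by simp
    ultimately have "(a + \<eta> *\<^sub>R l) \<bullet> e > b" by (simp add: inner_add_left)
    thus False using e(2) ax by simp
  qed
qed

lemma finite_halfspaces_\<Delta>: "finite E \<Longrightarrow> finite_halfspaces \<Delta>"
  using finite_halfspaces_hull_plus_cone[of E V] decomposition V by (simp add: C)

text \<open>Write \<open>u\<close> as a hull point plus an element \<open>c\<close> of
  \<open>C\<close>. If \<open>c\<close> is nonzero, a generator of \<open>C\<close> moves it.
  Otherwise \<open>u\<close> is a convex combination giving two vertices positive weight, and
  shifting weight between them moves \<open>u\<close> along their difference.\<close>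

lemma movable_\<Delta>:
  assumes E: "finite E" and ws: "V - {0} \<subseteq> set ws"
    "\<And>a b. a \<in> E \<Longrightarrow> b \<in> E \<Longrightarrow> a \<noteq> b \<Longrightarrow> b - a \<in> set ws"
    and u: "u \<in> \<Delta>" "u \<notin> E"
  shows "movable ws \<Delta> u"
proof -
  obtain e c where ec: "u = e + c" "e \<in> convex hull E" "c \<in> C"
    using u(1) decomposition[OF E] by blast
  show ?thesis
  proof (cases "c = 0")
    case False
    then obtain w t where w: "w \<in> set ws" "t > 0" "c + t *\<^sub>R w \<in> C" "c - t *\<^sub>R w \<in> C"
      using movable_conic_comb[OF V ws(1)] ec(3) unfolding C movable_def by blast
    have "u + t *\<^sub>R w = e + (c + t *\<^sub>R w)" "u - t *\<^sub>R w = e + (c - t *\<^sub>R w)" using ec(1) by auto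
    hence "u + t *\<^sub>R w \<in> \<Delta>" "u - t *\<^sub>R w \<in> \<Delta>" using w ec(2) decomposition[OF E] by blast+
    thus ?thesis unfolding movable_def using w by blast
  next
    case True
    obtain m where m: "\<forall>a\<in>E. 0 \<le> m a" "sum m E = 1" "u = (\<Sum>a\<in>E. m a *\<^sub>R a)"
      using ec(1,2) True convex_hull_finite[OF E] by auto
    obtain a where a: "a \<in> E" "m a \<noteq> 0" using m(2) by (metis sum.neutral zero_neq_one)
    have "\<exists>b\<in>E. b \<noteq> a \<and> m b \<noteq> 0"
    proof (rule ccontr)
      assume "\<not> ?thesis"
      hence z: "\<forall>b\<in>E - {a}. m b = 0" by blast
      have "m a = 1" using m(2) z E a(1) by (simp add: sum.remove)
      hence "u = a" using m(3) z E a(1) by (simp add: sum.remove)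
      thus False using u(2) a(1) by simp
    qed
    then obtain b where b: "b \<in> E" "b \<noteq> a" "m b \<noteq> 0" by blast
    \<comment> \<open>The largest weight that can pass in either direction between \<open>a\<close>
      and \<open>b\<close> while both stay nonnegative.\<close>
    define t where "t = min (m a) (m b)"
    have t: "t > 0" "t \<le> m a" "t \<le> m b" using a b m(1) by (auto simp: t_def less_le)
    have mem: "u + s *\<^sub>R (b - a) \<in> \<Delta>" if s: "\<bar>s\<bar> \<le> t" for s
    proof -
      define m' where "m' v = m v + ((if v = b then s else 0) - (if v = a then s else 0))" for v
      have "0 \<le> m' v" if "v \<in> E" for v
        using s t b(2) m(1) that by (auto simp: m'_def)
      moreover have "sum m' E = 1"
        using E a b m(2) by (simp add: m'_def sum.distrib sum_subtractf)
      moreover have "(\<Sum>v\<in>E. m' v *\<^sub>R v) = u + s *\<^sub>R (b - a)"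
        using E a(1) b(1) unfolding m'_def m(3)
        by (simp add: scaleR_add_left scaleR_diff_left sum.distrib sum_subtractf
            if_distrib[of "\<lambda>x. x *\<^sub>R _"] sum.delta scaleR_diff_right cong: if_cong)
      ultimately have "u + s *\<^sub>R (b - a) \<in> convex hull E"
        unfolding convex_hull_finite[OF E] by (intro CollectI exI[of _ m']) auto
      hence "u + s *\<^sub>R (b - a) + 0 \<in> \<Delta>"
        using decomposition[OF E] convex_cone_contains_0[OF CC] by blast
      thus ?thesis by simp
    qed
    have "u + t *\<^sub>R (b - a) \<in> \<Delta>" "u - t *\<^sub>R (b - a) \<in> \<Delta>"
      using mem[of t] mem[of "- t"] t(1) by auto
    moreover have "b - a \<in> set ws" using ws(2) a(1) b(1,2) by blast
    ultimately show ?thesis unfolding movable_def using t(1) by blast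
  qed
qed

text \<open>The vertex \<open>a\<close> itself and zero generators are left out, so that every
  element is a nonzero direction, as \<open>pointed_cone_functional\<close> demands.\<close>

definition tangent_gens where "tangent_gens a = (\<lambda>b. b - a) ` (E - {a}) \<union> (V - {0})"

lemma finite_tangent_gens: "finite E \<Longrightarrow> finite (tangent_gens a)"
  using V by (simp add: tangent_gens_def)

text \<open>That \<Delta> lies in the translated cone holds globally, by
  \<open>decomposition\<close>. Conversely, each constraint active at \<open>a\<close> is at most 0
  on the generators, hence on the cone, and near \<open>a\<close> the active constraints decide
  membership.\<close>

lemma tangent_cone_local:
  assumes E: "finite E" and a: "a \<in> E"
  obtains r where "r > 0" "\<And>z. dist a z < r \<Longrightarrow> z \<in> \<Delta> \<longleftrightarrow> z - a \<in> conic_comb (tangent_gens a)"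
proof -
  let ?T = "conic_comb (tangent_gens a)"
  have fin: "finite (tangent_gens a)" using E by (rule finite_tangent_gens)
  have CT: "convex_cone ?T" using fin by (rule convex_cone_conic_comb)
  have a\<Delta>: "a \<in> \<Delta>" using a by (simp add: E_def extreme_point_of_def)
  have sub1: "z - a \<in> ?T" if z: "z \<in> \<Delta>" for z
  proof -
    obtain e c where ec: "z = e + c" "e \<in> convex hull E" "c \<in> C"
      using z decomposition[OF E] by blast
    obtain m where m: "\<forall>a\<in>E. 0 \<le> m a" "sum m E = 1" "e = (\<Sum>a\<in>E. m a *\<^sub>R a)"
      using ec(2) convex_hull_finite[OF E] by auto
    have "z - a = (\<Sum>b\<in>E. m b *\<^sub>R (b - a)) + c"
      by (simp add: ec(1) m(3) scaleR_diff_right sum_subtractf flip: scaleR_left.sum m(2))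
        (simp add: m(2) flip: scaleR_left.sum)
    moreover have "(\<Sum>b\<in>E. m b *\<^sub>R (b - a)) \<in> ?T"
    proof (intro convex_cone_sum[OF CT] convex_cone_scaleR[OF CT])
      fix b assume b: "b \<in> E"
      show "b - a \<in> ?T"
      proof (cases "b = a")
        case False
        hence "b - a \<in> tangent_gens a" using b by (auto simp: tangent_gens_def)
        thus ?thesis using fin by (intro conic_comb_inc)
      qed (simp add: convex_cone_contains_0[OF CT])
    qed (use m in auto)
    moreover have "c \<in> ?T"
    proof -
      have "conic_comb (V - {0}) \<subseteq> ?T"
        using V fin by (simp add: conic_comb_eq_hull tangent_gens_def hull_mono)
      thus ?thesis using ec(3) V by (auto simp: C conic_comb_minus_0)
    qed
    ultimately show ?thesis using convex_cone_add[OF CT] by simp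
  qed
  obtain F where F: "finite F" "\<Delta> = {x. \<forall>(a, b)\<in>F. a \<bullet> x \<le> b}"
    using finite_halfspaces_\<Delta>[OF E] by (auto simp: finite_halfspaces_def)
  have a': "\<forall>(h, b)\<in>F. h \<bullet> a \<le> b" using a\<Delta> F by auto
  obtain r where r: "r > 0"
    "\<And>z. dist a z < r \<Longrightarrow> (\<forall>(h, b)\<in>F. h \<bullet> z \<le> b) \<longleftrightarrow> (\<forall>(h, b)\<in>F. h \<bullet> a = b \<longrightarrow> h \<bullet> z \<le> b)"
    using active_constraints[OF F(1) a'] by blast
  have sub2: "h \<bullet> x \<le> 0" if hb: "(h, b) \<in> F" "h \<bullet> a = b" and x: "x \<in> ?T" for h b x
  proof -
    have le: "h \<bullet> z \<le> b" if "z \<in> \<Delta>" for z using that hb(1) unfolding F(2) by auto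
    have "tangent_gens a \<subseteq> {x. h \<bullet> x \<le> 0}"
    proof
      fix w assume "w \<in> tangent_gens a"
      hence "a + w \<in> \<Delta>" unfolding tangent_gens_def
      proof
        assume "w \<in> (\<lambda>b. b - a) ` (E - {a})"
        thus ?thesis by (auto simp: E_def extreme_point_of_def)
      next
        assume "w \<in> V - {0}"
        hence "w \<in> C" using V by (simp add: C conic_comb_inc)
        thus ?thesis using recession a\<Delta> by blast
      qed
      from le[OF this] show "w \<in> {x. h \<bullet> x \<le> 0}" using hb(2) by (simp add: inner_add_right)
    qed
    hence "?T \<subseteq> {x. h \<bullet> x \<le> 0}"
      unfolding conic_comb_eq_hull[OF fin] by (intro hull_minimal convex_cone_halfspace_le)
    thus ?thesis using x by blast
  qed
  show thesis
  proof (rule that[OF r(1)])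
    fix z assume z: "dist a z < r"
    show "z \<in> \<Delta> \<longleftrightarrow> z - a \<in> ?T"
    proof
      assume T: "z - a \<in> ?T"
      have "h \<bullet> z \<le> b" if "(h, b) \<in> F" "h \<bullet> a = b" for h b
        using sub2[OF that T] that(2) by (simp add: inner_diff_right)
      thus "z \<in> \<Delta>" unfolding F(2) using r(2)[OF z] by blast
    qed (rule sub1)
  qed
qed

text \<open>If both \<open>w\<close> and \<open>- w\<close> were in the cone, short steps from
  \<open>a\<close> along them would stay in \<Delta> and make \<open>a\<close> the midpoint of a
  segment in \<Delta>.\<close>

lemma tangent_cone_pointed:
  assumes E: "finite E" and a: "a \<in> E" and w: "w \<in> conic_comb (tangent_gens a)" "w \<noteq> 0"
  shows "- w \<notin> conic_comb (tangent_gens a)"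
proof
  assume w': "- w \<in> conic_comb (tangent_gens a)"
  obtain r where r: "r > 0"
    "\<And>z. dist a z < r \<Longrightarrow> z \<in> \<Delta> \<longleftrightarrow> z - a \<in> conic_comb (tangent_gens a)"
    using tangent_cone_local[OF E a] by blast
  have CT: "convex_cone (conic_comb (tangent_gens a))"
    using finite_tangent_gens[OF E] by (rule convex_cone_conic_comb)
  define s where "s = r / (2 * norm w)"
  have s: "s > 0" "s * norm w < r" using r w(2) by (auto simp: s_def)
  have "a + s *\<^sub>R v \<in> \<Delta>" if v: "v \<in> conic_comb (tangent_gens a)" "norm v = norm w" for v
    using r(2)[of "a + s *\<^sub>R v"] s convex_cone_scaleR[OF CT _ v(1), of s] v(2) by (simp add: dist_norm)
  hence "a + s *\<^sub>R w \<in> \<Delta>" "a + s *\<^sub>R (- w) \<in> \<Delta>" using w(1) w' norm_minus_cancel by blast+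
  moreover have "a \<in> open_segment (a + s *\<^sub>R w) (a + s *\<^sub>R (- w))"
  proof -
    have "a = (1 - 1 / 2) *\<^sub>R (a + s *\<^sub>R w) + (1 / 2) *\<^sub>R (a + s *\<^sub>R (- w))"
      by (simp add: algebra_simps flip: scaleR_add_left)
    moreover have "a + s *\<^sub>R w \<noteq> a + s *\<^sub>R (- w)"
    proof
      assume "a + s *\<^sub>R w = a + s *\<^sub>R (- w)"
      hence "s *\<^sub>R w = s *\<^sub>R (- w)" by simp
      hence "w = - w" using s(1) by (metis less_irrefl scaleR_cancel_left)
      hence "2 *\<^sub>R w = 0" by (metis eq_neg_iff_add_eq_0 scaleR_2)
      thus False using w(2) by simp
    qed
    ultimately show ?thesis unfolding in_segment by (intro conjI exI[of _ "1 / 2"]) auto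
  qed
  ultimately show False using a unfolding E_def extreme_point_of_def by blast
qed

lemma tangent_cone_functional:
  assumes E: "finite E" and a: "a \<in> E"
  obtains l c where "c > 0" "\<And>u. u \<in> conic_comb (tangent_gens a) \<Longrightarrow> c * norm u \<le> l \<bullet> u"
proof (rule pointed_cone_functional[OF finite_tangent_gens[OF E]])
  show "0 \<notin> tangent_gens a" by (auto simp: tangent_gens_def)
  thus "- w \<notin> conic_comb (tangent_gens a)" if "w \<in> tangent_gens a" for w
    using tangent_cone_pointed[OF E a] conic_comb_inc[OF finite_tangent_gens[OF E] that] that by metis
qed (rule that)

end

section \<open>Numerators, local cones and the final identity\<close>

lemma local_cone_eqI:
  "is_local_cone C A a K \<Longrightarrow> local_cone C A a = K"
  unfolding local_cone_def by (rule the_equality, assumption) (rule local_cone_unique)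

lemma (in cocompact_convex) local_cone_eq:
  assumes E: "finite E" and a: "a \<in> E" and 0: "0 \<notin> \<Delta>" and A: "A = C - (\<Delta> \<union> {0})"
  shows "local_cone C A a = conic_comb (tangent_gens a)"
proof (rule local_cone_eqI)
  obtain r where r: "r > 0"
    "\<And>z. dist a z < r \<Longrightarrow> z \<in> \<Delta> \<longleftrightarrow> z - a \<in> conic_comb (tangent_gens a)"
    using tangent_cone_local[OF E a] by blast
  have a\<Delta>: "a \<in> \<Delta>" using a by (simp add: E_def extreme_point_of_def)
  have "C - A = insert 0 \<Delta>" using A sub convex_cone_contains_0[OF CC] by blast
  hence cl: "closure (C - A) = insert 0 \<Delta>" using closed by simp
  \<comment> \<open>As 0 is in neither \<open>A\<close> nor \<Delta>, it survives in
    \<open>C - A\<close> as an extra point; the bound \<open>norm a\<close> keeps it out of the ball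
    around the vertex.\<close>
  define e where "e = min r (norm a)"
  have "e > 0" using r(1) 0 a\<Delta> by (auto simp: e_def)
  moreover have "conic_comb (tangent_gens a) \<inter> ball 0 e = (\<lambda>x. x - a) ` closure (C - A) \<inter> ball 0 e"
  proof (rule set_eqI)
    fix u
    have "u \<in> conic_comb (tangent_gens a) \<longleftrightarrow> u \<in> (\<lambda>x. x - a) ` insert 0 \<Delta>" if u: "norm u < e"
    proof -
      have "dist a (a + u) < r" using u by (simp add: e_def dist_norm)
      from r(2)[OF this] have "u \<in> conic_comb (tangent_gens a) \<longleftrightarrow> a + u \<in> \<Delta>" by simp
      also have "\<dots> \<longleftrightarrow> u \<in> (\<lambda>x. x - a) ` \<Delta>" by (force simp: image_iff algebra_simps)
      also have "\<dots> \<longleftrightarrow> u \<in> (\<lambda>x. x - a) ` insert 0 \<Delta>" using u by (auto simp: e_def)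
      finally show ?thesis .
    qed
    thus "u \<in> conic_comb (tangent_gens a) \<inter> ball 0 e \<longleftrightarrow>
        u \<in> (\<lambda>x. x - a) ` closure (C - A) \<inter> ball 0 e"
      unfolding cl by auto
  qed
  ultimately show "is_local_cone C A a (conic_comb (tangent_gens a))"
    unfolding is_local_cone_def using cone_conic_comb[OF finite_tangent_gens[OF E]] by blast
qed

text \<open>At a lattice point \<open>b\<close> the radius of invariance is \<open>e\<close> times
  its norm, which exceeds twice the total length of \<open>ws\<close> outside a ball. The
  differences vanish there, and a ball contains finitely many lattice points.\<close>

lemma cone_numerator:
  fixes K :: "(real ^ 'n::{finite,linorder}) set"
  assumes "cone K" "finite_halfspaces K"
    and "\<And>u. u \<in> K \<Longrightarrow> u \<noteq> 0 \<Longrightarrow> movable (map lattice_point ws) K u"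
  obtains p :: "'n laurent"
    where "Poly_Mapping.lookup p = diffs ws (\<lambda>b. indicator K (lattice_point b))"
proof -
  let ?ws = "map lattice_point ws :: (real ^ 'n::{finite,linorder}) list"
  let ?f = "diffs ws (\<lambda>b. indicator K (lattice_point b) :: complex)"
  obtain e where e: "e > 0" "\<And>y. y \<noteq> 0 \<Longrightarrow> locally_invariant ?ws K y (e * norm y)"
    using locally_invariant_cone_uniform[OF assms] by blast
  let ?L = "\<Sum>w\<leftarrow>?ws. norm w"
  have "norm (lattice_point b) \<le> \<bar>2 * ?L / e\<bar>" if b: "?f b \<noteq> 0" for b
  proof (rule ccontr)
    assume n: "\<not> norm (lattice_point b) \<le> \<bar>2 * ?L / e\<bar>"
    hence "lattice_point b \<noteq> 0" by auto
    moreover have "2 * ?L < e * norm (lattice_point b)"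
      using n e(1) by (simp add: pos_divide_less_eq mult.commute not_le abs_less_iff)
    ultimately have "diffs ?ws (indicator K :: _ \<Rightarrow> complex) (lattice_point b) = 0"
      using e(2) by (intro diffs_indicator_eq_0)
    moreover have "?f b = diffs ?ws (indicator K) (lattice_point b)"
      by (rule diffs_comp) (rule lattice_point_diff)
    ultimately show False using b by simp
  qed
  hence "{b. ?f b \<noteq> 0} \<subseteq> {b. lattice_point b \<in> cball 0 \<bar>2 * ?L / e\<bar>}" by auto
  hence "finite {b. ?f b \<noteq> 0}"
    by (rule finite_subset) (intro finite_bounded_lattice_points bounded_cball)
  hence "Poly_Mapping.lookup (Abs_poly_mapping ?f) = ?f" by (rule lookup_Abs_poly_mapping)
  thus thesis by (rule that)
qed

lemma sum_Fract:
  fixes q :: "'a::idom"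
  assumes "q \<noteq> 0"
  shows "(\<Sum>i\<in>I. Fract (f i) q) = Fract (\<Sum>i\<in>I. f i) q"
proof (induction I rule: infinite_finite_induct)
  case (insert i I)
  have "Fract (f i) q + Fract (sum f I) q = Fract (q * (f i + sum f I)) (q * q)"
    using assms by (simp add: algebra_simps)
  also have "\<dots> = Fract (f i + sum f I) q" using assms by (rule mult_fract_cancel)
  finally show ?case using insert by simp
qed (use assms in \<open>simp_all add: fract_collapse\<close>)

theorem theoremC:
  fixes C A :: "(real ^ 'n::{finite,linorder}) set"
  assumes "closed C"
    and "strictly_convex_cone C"
    and "integer_cone C"
    and "interior C \<noteq> {}"
    and "coconvex_integer_polytope C A"
  shows "gf_bounded A =
    - (\<Sum>a | lattice_point a \<in> Vert C A - {0}.
          ratfun_monom a * gf_cone (local_cone C A (lattice_point a)))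
    + gf_cone C - 1"
proof -
  obtain V where gens: "finite V" "\<forall>v\<in>V. integral_vec v" "C = conic_comb V"
    using assms(3) by (auto simp: integer_cone_def conic_comb_def)
  obtain \<Delta> where co: "coconvex_integer_complement C A \<Delta>"
    using assms(5) by (auto simp: coconvex_integer_polytope_def)
  have \<Delta>: "closed \<Delta>" "convex \<Delta>" "\<Delta> \<subseteq> C" "bounded (C - \<Delta>)" "A = C - (\<Delta> \<union> {0})"
    "\<And>a. a extreme_point_of \<Delta> \<Longrightarrow> integral_vec a"
    using co by (auto simp: coconvex_integer_complement_def)
  have coneC: "cone C" and noline: "\<not> (\<exists>p v. v \<noteq> 0 \<and> (\<forall>t. p + t *\<^sub>R v \<in> C))"
    using assms(2) by (auto simp: strictly_convex_cone_def)
  have "w = 0" if w: "w \<in> C" "- w \<in> C" for w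
  proof (rule ccontr)
    assume "w \<noteq> 0"
    have "0 + t *\<^sub>R w \<in> C" for t
      using mem_cone[OF coneC w(1), of t] mem_cone[OF coneC w(2), of "- t"] by (cases "t \<ge> 0") auto
    with \<open>w \<noteq> 0\<close> noline show False by blast
  qed
  then interpret cocompact_convex C \<Delta> V using gens \<Delta> by unfold_locales auto
  have Vert: "Vert C A - {0} = E" using coconvex_Vert(2)[OF coneC co] by (simp add: E_def)
  have 0: "0 \<notin> \<Delta>" using coconvex_Vert(1)[OF coneC co] by blast
  \<comment> \<open>The statement sums over exponent vectors, the geometry over vectors. Integrality
    of the vertices identifies the two index sets.\<close>
  define Ez where "Ez = {a :: 'n \<Rightarrow>\<^sub>0 int. lattice_point a \<in> E}"
  have "finite Ez" unfolding Ez_def using bounded_E by (rule finite_bounded_lattice_points)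
  have EEz: "E = lattice_point ` Ez"
    using \<Delta>(6) by (auto simp: Ez_def E_def integral_vec_iff)
  have E: "finite E" unfolding EEz using \<open>finite Ez\<close> by simp

  \<comment> \<open>The subtraction of 0 applies to the whole union, so every factor of
    \<open>q\<close> is nonzero. Differences are taken over ordered pairs, which covers the
    generators of all tangent cones at once.\<close>
  define D where "D = (\<lambda>(a, b). b - a) ` (E \<times> E) \<union> V - {0}"
  have "finite D" using E gens(1) by (simp add: D_def)
  have "D \<subseteq> range (lattice_point :: ('n \<Rightarrow>\<^sub>0 int) \<Rightarrow> _)"
  proof
    fix w assume "w \<in> D"
    hence "w \<in> V \<or> (\<exists>a\<in>Ez. \<exists>b\<in>Ez. w = lattice_point (b - a))"
      by (auto simp: D_def EEz lattice_point_diff)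
    thus "w \<in> range (lattice_point :: ('n \<Rightarrow>\<^sub>0 int) \<Rightarrow> _)" using gens(2) integral_vec_iff by blast
  qed
  then obtain Z :: "('n \<Rightarrow>\<^sub>0 int) set" where Z: "finite Z" "D = lattice_point ` Z"
    using \<open>finite D\<close> by (metis finite_subset_image)
  obtain ws where ws: "set ws = Z" using finite_list[OF Z(1)] by blast
  have setws: "set (map lattice_point ws) = D" using ws Z(2) by simp
  have ws0: "0 \<notin> set ws"
  proof
    assume "0 \<in> set ws"
    hence "lattice_point 0 \<in> D" using Z(2) ws by blast
    thus False by (simp add: lattice_point_0 D_def)
  qed
  define q where "q = binomial_prod ws"
  have q0: "q \<noteq> 0" unfolding q_def using ws0 by (rule binomial_prod_nonzero)

  define T where "T a = conic_comb (tangent_gens a)" for a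
  have Vws: "V - {0} \<subseteq> set (map lattice_point ws)" unfolding setws by (auto simp: D_def)
  have Ews: "b - a \<in> set (map lattice_point ws)" if "a \<in> E" "b \<in> E" "a \<noteq> b" for a b
    unfolding setws D_def using that by force
  have movC: "movable (map lattice_point ws) C u" if "u \<in> C" "u \<noteq> 0" for u
    using movable_conic_comb[OF gens(1) Vws] that by (simp add: gens(3))
  have movT: "movable (map lattice_point ws) (T a) u" if "a \<in> E" "u \<in> T a" "u \<noteq> 0" for a u
  proof -
    have "tangent_gens a - {0} \<subseteq> set (map lattice_point ws)"
      using Vws Ews that(1) by (auto simp: tangent_gens_def)
    thus ?thesis using movable_conic_comb[OF finite_tangent_gens[OF E]] that by (simp add: T_def)
  qed
  have hC: "finite_halfspaces C" unfolding gens(3) by (rule finite_halfspaces_conic_comb[OF gens(1)])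
  have hT: "finite_halfspaces (T a)" "cone (T a)" for a
    unfolding T_def using finite_tangent_gens[OF E]
    by (rule finite_halfspaces_conic_comb cone_conic_comb)+

  obtain pC :: "'n laurent"
    where pC: "Poly_Mapping.lookup pC = diffs ws (\<lambda>b. indicator C (lattice_point b))"
    using cone_numerator[OF coneC hC movC] by blast
  have gC: "gf_cone C = Fract pC q"
  proof -
    obtain l c where "c > 0" "\<And>u. u \<in> C \<Longrightarrow> c * norm u \<le> l \<bullet> u" using C_functional by blast
    thus ?thesis unfolding q_def by (rule gf_cone_eq[OF _ _ ws0 pC])
  qed
  have "\<exists>p :: 'n laurent. Poly_Mapping.lookup p = diffs ws (\<lambda>b. indicator (T a) (lattice_point b))"
    if "a \<in> E" for a
    using cone_numerator[OF hT(2) hT(1) movT[OF that]] by blast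
  then obtain p :: "real ^ 'n::{finite,linorder} \<Rightarrow> 'n laurent" where
    p: "\<And>a. a \<in> E \<Longrightarrow> Poly_Mapping.lookup (p a) = diffs ws (\<lambda>b. indicator (T a) (lattice_point b))"
    by metis
  have gT: "gf_cone (local_cone C A a) = Fract (p a) q" if a: "a \<in> E" for a
  proof -
    obtain l c where "c > 0" "\<And>u. u \<in> T a \<Longrightarrow> c * norm u \<le> l \<bullet> u"
      using tangent_cone_functional[OF E a] unfolding T_def by blast
    hence "gf_cone (T a) = Fract (p a) q" unfolding q_def by (rule gf_cone_eq[OF _ _ ws0 p[OF a]])
    thus ?thesis using local_cone_eq[OF E a 0 \<Delta>(5)] by (simp add: T_def)
  qed
  have finA: "finite {a :: 'n \<Rightarrow>\<^sub>0 int. lattice_point a \<in> A}"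
    by (intro finite_bounded_lattice_points bounded_subset[OF \<Delta>(4)]) (use \<Delta>(5) in blast)
  define g :: "'n laurent" where "g = (\<Sum>a | lattice_point a \<in> A. Poly_Mapping.single a 1)"
  have gA: "gf_bounded A = Fract g 1"
    by (simp add: gf_bounded_def ratfun_monom_def g_def sum_Fract)
  have g: "Poly_Mapping.lookup g = (\<lambda>b. indicator A (lattice_point b))"
    using finA by (auto simp: g_def lookup_sum lookup_single when_def indicator_def fun_eq_iff)

  obtain B where B: "\<And>x. x \<in> C \<Longrightarrow> norm x \<ge> B \<Longrightarrow> x \<in> \<Delta>" using far by blast
  \<comment> \<open>The cone describing \<Delta> at infinity is \<open>C\<close>: the two differ by
    a bounded set.\<close>
  have brion: "diffs (map lattice_point ws)
      (\<lambda>y. indicator \<Delta> y - (\<Sum>a\<in>E. indicator (T a) (y - a)) :: complex) = (\<lambda>_. 0)"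
  proof (rule diffs_indicator_tangent_cones[OF E finite_halfspaces_\<Delta>[OF E] _ coneC hC movC _ hT(2,1) movT])
    show "movable (map lattice_point ws) \<Delta> u" if "u \<in> \<Delta>" "u \<notin> E" for u
      using movable_\<Delta>[OF E Vws Ews that] by blast
    show "z \<in> \<Delta> \<longleftrightarrow> z \<in> C" if "norm z \<ge> B" for z using B that sub by blast
    show "\<exists>r>0. \<forall>z. dist a z < r \<longrightarrow> (z \<in> \<Delta>) = (z - a \<in> T a)" if "a \<in> E" for a
      using tangent_cone_local[OF E that] unfolding T_def by metis
  qed
  have brion_lattice: "diffs ws (\<lambda>b. indicator \<Delta> (lattice_point b) :: complex) b =
      (\<Sum>a\<in>Ez. Poly_Mapping.lookup (p (lattice_point a)) (b - a))" for b
  proof -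
    have "diffs ws (\<lambda>b. indicator \<Delta> (lattice_point b) -
        (\<Sum>a\<in>E. indicator (T a) (lattice_point b - a)) :: complex) b = 0"
      using diffs_comp[OF lattice_point_diff, of ws "\<lambda>y. indicator \<Delta> y -
        (\<Sum>a\<in>E. indicator (T a) (y - a)) :: complex" b] unfolding brion by simp
    hence "diffs ws (\<lambda>b. indicator \<Delta> (lattice_point b) :: complex) b =
        (\<Sum>a\<in>E. diffs ws (\<lambda>b. indicator (T a) (lattice_point b - a)) b)"
      by (simp only: diffs_diff diffs_sum right_minus_eq)
    also have "\<dots> = (\<Sum>a\<in>Ez. diffs ws (\<lambda>b. indicator (T (lattice_point a)) (lattice_point (b - a))) b)"
      unfolding EEz lattice_point_diff
      by (subst sum.reindex) (auto intro: inj_on_subset[OF inj_lattice_point])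
    also have "\<dots> = (\<Sum>a\<in>Ez. Poly_Mapping.lookup (p (lattice_point a)) (b - a))"
    proof (rule sum.cong)
      fix a assume "a \<in> Ez"
      hence "lattice_point a \<in> E" by (simp add: Ez_def)
      thus "diffs ws (\<lambda>b. indicator (T (lattice_point a)) (lattice_point (b - a))) b =
          Poly_Mapping.lookup (p (lattice_point a)) (b - a)"
        using diffs_shift[of ws "\<lambda>b. indicator (T (lattice_point a)) (lattice_point b)" a b] p
        by simp
    qed simp
    finally show ?thesis .
  qed
  have key: "q * g = pC - (\<Sum>a\<in>Ez. Poly_Mapping.single a 1 * p (lattice_point a)) - q"
  proof (rule poly_mapping_eqI)
    fix b
    \<comment> \<open>The origin belongs to \<open>C\<close> but neither to \<Delta> nor to
      \<open>A\<close>; it contributes the coefficient function of the polynomial 1, and so the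
      final \<open>- 1\<close> of the theorem.\<close>
    have "(indicator A (lattice_point b) :: complex) =
        indicator C (lattice_point b) - indicator \<Delta> (lattice_point b) - Poly_Mapping.lookup 1 b" for b
      using 0 sub \<Delta>(5) convex_cone_contains_0[OF CC] inj_lattice_point
      by (auto simp: indicator_def lookup_one when_def lattice_point_0 inj_eq[OF inj_lattice_point, of _ 0, unfolded lattice_point_0])
    hence "diffs ws (Poly_Mapping.lookup g) b = diffs ws (\<lambda>b. indicator C (lattice_point b) -
        indicator \<Delta> (lattice_point b) - Poly_Mapping.lookup 1 b) b" unfolding g by simp
    also have "\<dots> = Poly_Mapping.lookup pC b - (\<Sum>a\<in>Ez. Poly_Mapping.lookup (p (lattice_point a)) (b - a))
        - Poly_Mapping.lookup q b"
      using lookup_binomial_prod_mult[of ws 1]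
      by (simp only: diffs_diff brion_lattice pC q_def mult_1_right)
    finally show "Poly_Mapping.lookup (q * g) b = Poly_Mapping.lookup
        (pC - (\<Sum>a\<in>Ez. Poly_Mapping.single a 1 * p (lattice_point a)) - q) b"
      by (simp add: q_def lookup_binomial_prod_mult lookup_minus lookup_sum lookup_single_mult)
  qed
  have Fdiff: "Fract x q - Fract y q = Fract (x - y) q" for x y
  proof -
    have "Fract (x - y) q + Fract y q = Fract ((x - y) + y) q"
      \<comment> \<open>Addition over a common denominator, obtained as a two-term sum indexed by
        \<open>bool\<close>.\<close>
      using sum_Fract[OF q0, of "\<lambda>b. if b then y else x - y" UNIV] by (simp only: UNIV_bool) simp
    thus ?thesis by (simp only: diff_add_cancel flip: eq_diff_eq)
  qed
  have vertex_sum: "(\<Sum>a | lattice_point a \<in> Vert C A - {0}.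
          ratfun_monom a * gf_cone (local_cone C A (lattice_point a))) =
      Fract (\<Sum>a\<in>Ez. Poly_Mapping.single a 1 * p (lattice_point a)) q"
    unfolding Vert Ez_def[symmetric] sum_Fract[OF q0, symmetric]
    by (rule sum.cong) (auto simp: ratfun_monom_def gT Ez_def)
  have one: "(1 :: 'n ratfun) = Fract q q" using q0 by (simp add: One_fract_def eq_fract)
  have reorder: "x - y - z = - y + x - z" for x y z :: "'n ratfun" by simp
  have "Fract g 1 = Fract (q * g) q" using q0 by (simp add: eq_fract)
  also have "\<dots> = Fract pC q - Fract (\<Sum>a\<in>Ez. Poly_Mapping.single a 1 * p (lattice_point a)) q - 1"
    unfolding key one by (simp only: Fdiff)
  finally show ?thesis unfolding gA gC vertex_sum reorder .
qed

end
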